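(* Let $g \in \mathcal{H}^1[a,b]$, and let $u$, $T_D$, $u_\psi$ and $G$ be the associated objects defined in the context. Then: (i) For every $\psi \in \mathcal{L}^2[a,b]$, $$G(\psi) = \|u' - u_\psi'\|_{\mathcal{L}^2}^2 = \int_a^b \left[ \left((u')^2 - (u_\psi')^2\right) - 2 (T_D\psi)(u - u_\psi) \right] dx .$$ (ii) For every $\psi_1,\psi_2 \in \mathcal{L}^2[a,b]$, $$G(\psi_1) - G(\psi_2) = \int_a^b -2\,\big(T_D(\psi_1-\psi_2)\big)\left(u - \frac{u_{\psi_1}+u_{\psi_2}}{2}\right) dx .$$ (iii) For every $\psi \in \mathcal{L}^2[a,b]$, the first Gâteaux derivative of $G$ at $\psi$ is given, for $h \in \mathcal{L}^2[a,b]$, by $$G'(\psi)[h] = \int_a^b (T_D h)\,\big(-2(u-u_\psi)\big)\,dx ,$$ and the $\mathcal{L}^2$-gradient of $G$ at $\psi$ is $$\nabla^{\psi}_{\mathcal{L}^2} G = T_D^*\big(-2(u-u_\psi)\big),$$ where the adjoint $T_D^*$ of $T_D$ on $\mathcal{L}^2[a,b]$ is given, for any $f\in\mathcal{L}^2[a,b]$, by $(T_D^* f)(x) = \int_x^b f(\xi)\,d\xi$ for all $x\in[a,b]$. (iv) For every $\psi \in \mathcal{L}^2[a,b]$, the second Gâteaux derivative of $G$ at $\psi$ is given, for $h,k\in\mathcal{L}^2[a,b]$, by $$G''(\psi)[h,k] = 2\left(-\Delta^{-1}(T_D h),\, T_D k\right)_{\mathcal{L}^2}.$$ Hence for every $\psi\in\mathcal{L}^2[a,b]$,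 $G''(\psi)$ is a positive definite quadratic form, i.e. $G''(\psi)[h,h] > 0$ for every nonzero $h\in \mathcal{L}^2[a,b]$.
   Context: All functions are real-valued on a bounded closed interval $[a,b]\subset\mathbb{R}$, $a<b$. $\mathcal{L}^2[a,b]$ has its usual inner product $(\cdot,\cdot)_{\mathcal{L}^2}$, and $\mathcal{H}^q[a,b]$ is the usual Sobolev space of functions $f$ with $f,f',\dots,f^{(q)}\in\mathcal{L}^2[a,b]$ (weak derivatives). $\mathcal{H}^q_0[a,b]$ denotes the set of $f\in\mathcal{H}^q[a,b]$ vanishing at the boundary, meaning $f(a)=f(b)=0$ (only the function values vanish, not the derivatives). The operator $T_D:\mathcal{L}^2[a,b]\to\mathcal{L}^2[a,b]$ is $(T_D\psi)(x)=\int_a^x\psi(\xi)\,d\xi$. For $g\in\mathcal{H}^1[a,b]$, $u\in\mathcal{H}^3_0[a,b]$ is the unique function with $-u''=g-g(a)$ and $u(a)=u(b)=0$. For $\psi\in\mathcal{L}^2[a,b]$, $u_\psi$ is the unique solution of $-u_\psi''=T_D\psi$ with $u_\psi(a)=u(a)=0$ and $u_\psi(b)=u(b)=0$. The functional $G:\mathcal{L}^2[a,b]\to\mathbb{R}$ is $G(\psi)=\|u_\psi'-u'\|_{\mathcal{L}^2}^2$. $\Delta=\frac{d^2}{dx^2}$ with domain $\mathcal{H}^2_0[a,b]$, and $-\Delta^{-1}f$ denotes the unique $y\in\mathcal{H}^2_0[a,b]$ with $-y''=f$. The Gâteaux derivatives are $G'(\psi)[h]=\lim_{\epsilon\to0}\frac{G(\psi+\epsilon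 h)-G(\psi)}{\epsilon}$ and $G''(\psi)[h,k]=\lim_{\epsilon\to0}\frac{G'(\psi+\epsilon h)[k]-G'(\psi)[k]}{\epsilon}$. The $\mathcal{L}^2$-gradient $\nabla^\psi_{\mathcal{L}^2}G$ is the element of $\mathcal{L}^2[a,b]$ with $G'(\psi)[h]=(h,\nabla^\psi_{\mathcal{L}^2}G)_{\mathcal{L}^2}$ for all $h\in\mathcal{L}^2[a,b]$. *)

theory Defs
  imports "HOL-Analysis.Analysis"
begin

text \<open>
  Elements of L2[a,b] are represented by functions on the real line, of which only the restriction
  to [a,b] matters; equality in L2[a,b] is equality almost everywhere on [a,b].
\<close>

definition L2 :: "real \<Rightarrow> real \<Rightarrow> (real \<Rightarrow> real) \<Rightarrow> bool" where
  "L2 a b f \<longleftrightarrow> f \<in> borel_measurable (lebesgue_on {a..b}) \<and>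
                integrable (lebesgue_on {a..b}) (\<lambda>x. (f x)\<^sup>2)"

definition L2_eq :: "real \<Rightarrow> real \<Rightarrow> (real \<Rightarrow> real) \<Rightarrow> (real \<Rightarrow> real) \<Rightarrow> bool" where
  "L2_eq a b f g \<longleftrightarrow> (AE x in lebesgue_on {a..b}. f x = g x)"

definition L2_inner :: "real \<Rightarrow> real \<Rightarrow> (real \<Rightarrow> real) \<Rightarrow> (real \<Rightarrow> real) \<Rightarrow> real" where
  "L2_inner a b f g = (LINT x|lebesgue_on {a..b}. f x * g x)"

definition L2_norm :: "real \<Rightarrow> real \<Rightarrow> (real \<Rightarrow> real) \<Rightarrow> real" where
  "L2_norm a b f = sqrt (L2_inner a b f f)"

definition test_function :: "real \<Rightarrow> real \<Rightarrow> (real \<Rightarrow> real) \<Rightarrow> bool" where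
  "test_function a b \<phi> \<longleftrightarrow> (\<forall>n x. (deriv ^^ n) \<phi> field_differentiable (at x)) \<and>
                           closure {x. \<phi> x \<noteq> 0} \<subseteq> {a<..<b}"

definition weak_deriv :: "real \<Rightarrow> real \<Rightarrow> nat \<Rightarrow> (real \<Rightarrow> real) \<Rightarrow> (real \<Rightarrow> real) \<Rightarrow> bool" where
  "weak_deriv a b n f D \<longleftrightarrow> L2 a b f \<and> L2 a b D \<and>
     (\<forall>\<phi>. test_function a b \<phi> \<longrightarrow>
        L2_inner a b f ((deriv ^^ n) \<phi>) = (- 1) ^ n * L2_inner a b D \<phi>)"

text \<open>
  For positive order, the Sobolev space is taken to consist of the continuous representatives,
  which exist in dimension one; point values such as the boundary values refer to these.
\<close>

definition sobolev :: "nat \<Rightarrow> real \<Rightarrow> real \<Rightarrow> (real \<Rightarrow> real) \<Rightarrow> bool" where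
  "sobolev q a b f \<longleftrightarrow> (q > 0 \<longrightarrow> continuous_on {a..b} f) \<and> (\<forall>n\<le>q. \<exists>D. weak_deriv a b n f D)"

definition sobolev0 :: "nat \<Rightarrow> real \<Rightarrow> real \<Rightarrow> (real \<Rightarrow> real) \<Rightarrow> bool" where
  "sobolev0 q a b f \<longleftrightarrow> sobolev q a b f \<and> f a = 0 \<and> f b = 0"

text \<open>A representative of the first weak derivative, determined up to a null set.\<close>

definition wderiv :: "real \<Rightarrow> real \<Rightarrow> (real \<Rightarrow> real) \<Rightarrow> real \<Rightarrow> real" where
  "wderiv a b f = (SOME D. weak_deriv a b 1 f D)"

text \<open>
  The solution y of -y'' = f in the Sobolev space of order q with y(a) = y(b) = 0. The value 0
  outside [a,b] is prescribed only to make the representing function on the real line unique.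
\<close>

definition dirichlet_sol :: "nat \<Rightarrow> real \<Rightarrow> real \<Rightarrow> (real \<Rightarrow> real) \<Rightarrow> real \<Rightarrow> real" where
  "dirichlet_sol q a b f =
     (THE y. sobolev0 q a b y \<and> weak_deriv a b 2 y (\<lambda>x. - f x) \<and> (\<forall>x. x \<notin> {a..b} \<longrightarrow> y x = 0))"

definition neg_inv_laplacian :: "real \<Rightarrow> real \<Rightarrow> (real \<Rightarrow> real) \<Rightarrow> real \<Rightarrow> real" where
  "neg_inv_laplacian a b f = dirichlet_sol 2 a b f"

definition T_D :: "real \<Rightarrow> (real \<Rightarrow> real) \<Rightarrow> real \<Rightarrow> real" where
  "T_D a \<psi> x = (LINT \<xi>|lebesgue_on {a..x}. \<psi> \<xi>)"

definition u_data :: "real \<Rightarrow> real \<Rightarrow> (real \<Rightarrow> real) \<Rightarrow> real \<Rightarrow> real" where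
  "u_data a b g = dirichlet_sol 3 a b (\<lambda>x. g x - g a)"

definition u_sol :: "real \<Rightarrow> real \<Rightarrow> (real \<Rightarrow> real) \<Rightarrow> real \<Rightarrow> real" where
  "u_sol a b \<psi> = dirichlet_sol 2 a b (T_D a \<psi>)"

definition G_fun :: "real \<Rightarrow> real \<Rightarrow> (real \<Rightarrow> real) \<Rightarrow> (real \<Rightarrow> real) \<Rightarrow> real" where
  "G_fun a b g \<psi> =
     (L2_norm a b (\<lambda>x. wderiv a b (u_sol a b \<psi>) x - wderiv a b (u_data a b g) x))\<^sup>2"

definition has_gateaux_deriv ::
    "((real \<Rightarrow> real) \<Rightarrow> real) \<Rightarrow> (real \<Rightarrow> real) \<Rightarrow> (real \<Rightarrow> real) \<Rightarrow> real \<Rightarrow> bool" where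
  "has_gateaux_deriv F \<psi> h D \<longleftrightarrow>
     ((\<lambda>\<epsilon>. (F (\<lambda>x. \<psi> x + \<epsilon> * h x) - F \<psi>) / \<epsilon>) \<longlongrightarrow> D) (at 0)"

definition gateaux_deriv ::
    "((real \<Rightarrow> real) \<Rightarrow> real) \<Rightarrow> (real \<Rightarrow> real) \<Rightarrow> (real \<Rightarrow> real) \<Rightarrow> real" where
  "gateaux_deriv F \<psi> h = Lim (at 0) (\<lambda>\<epsilon>. (F (\<lambda>x. \<psi> x + \<epsilon> * h x) - F \<psi>) / \<epsilon>)"

definition has_gateaux_deriv2 ::
    "((real \<Rightarrow> real) \<Rightarrow> real) \<Rightarrow> (real \<Rightarrow> real) \<Rightarrow> (real \<Rightarrow> real) \<Rightarrow> (real \<Rightarrow> real) \<Rightarrow> real \<Rightarrow> bool" where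
  "has_gateaux_deriv2 F \<psi> h k D \<longleftrightarrow> has_gateaux_deriv (\<lambda>\<phi>. gateaux_deriv F \<phi> k) \<psi> h D"

definition gateaux_deriv2 ::
    "((real \<Rightarrow> real) \<Rightarrow> real) \<Rightarrow> (real \<Rightarrow> real) \<Rightarrow> (real \<Rightarrow> real) \<Rightarrow> (real \<Rightarrow> real) \<Rightarrow> real" where
  "gateaux_deriv2 F \<psi> h k = gateaux_deriv (\<lambda>\<phi>. gateaux_deriv F \<phi> k) \<psi> h"

definition is_L2_gradient ::
    "real \<Rightarrow> real \<Rightarrow> ((real \<Rightarrow> real) \<Rightarrow> real) \<Rightarrow> (real \<Rightarrow> real) \<Rightarrow> (real \<Rightarrow> real) \<Rightarrow> bool" where
  "is_L2_gradient a b F \<psi> z \<longleftrightarrow>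
     L2 a b z \<and> (\<forall>h. L2 a b h \<longrightarrow> has_gateaux_deriv F \<psi> h (L2_inner a b h z))"

definition is_L2_adjoint ::
    "real \<Rightarrow> real \<Rightarrow> ((real \<Rightarrow> real) \<Rightarrow> real \<Rightarrow> real) \<Rightarrow> ((real \<Rightarrow> real) \<Rightarrow> real \<Rightarrow> real) \<Rightarrow> bool" where
  "is_L2_adjoint a b T S \<longleftrightarrow>
     (\<forall>f. L2 a b f \<longrightarrow> L2 a b (T f)) \<and> (\<forall>f. L2 a b f \<longrightarrow> L2 a b (S f)) \<and>
     (\<forall>f h. L2 a b f \<longrightarrow> L2 a b h \<longrightarrow> L2_inner a b (T f) h = L2_inner a b f (S h))"

end

theory Submission
  imports Defs
begin

text \<open>
  For continuous \<open>f\<close> the weak Dirichlet problem \<open>- y'' = f\<close> is solved by the classical solution obtained by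
  integrating twice, and by the lemma of du Bois-Reymond it has no other weak solution. If \<open>y\<^sub>i\<close> solves it
  for the right-hand side \<open>f\<^sub>i\<close>, then Green's identity \<open>\<integral> f\<^sub>1 y\<^sub>2 = \<integral> y\<^sub>1' y\<^sub>2' = \<integral> y\<^sub>1 f\<^sub>2\<close> makes \<open>G\<close> the square of
  a seminorm evaluated at \<open>T\<^sub>D \<psi> - (g - g(a))\<close>. Parts (i) and (ii) are expansions of this square, the
  difference quotients of \<open>G\<close> and \<open>G'\<close> are affine in the increment, and \<open>G''(\<psi>)[h,h]\<close> is twice the energy of the
  solution for \<open>T\<^sub>D h\<close>. It vanishes only if \<open>T\<^sub>D h = 0\<close>, that is \<open>h = 0\<close>, as \<open>h\<close> is the weak derivative of \<open>T\<^sub>D h\<close>.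
\<close>

section \<open>Square-integrable functions on an interval\<close>

lemma L2_integrable_mult:
  assumes "L2 a b f" "L2 a b g"
  shows "integrable (lebesgue_on {a..b}) (\<lambda>x. f x * g x)"
proof (rule Bochner_Integration.integrable_bound)
  show "integrable (lebesgue_on {a..b}) (\<lambda>x. (f x)\<^sup>2 + (g x)\<^sup>2)"
    using assms by (auto simp: L2_def)
  show "(\<lambda>x. f x * g x) \<in> borel_measurable (lebesgue_on {a..b})"
    using assms by (auto simp: L2_def)
  have "\<bar>f x * g x\<bar> \<le> (f x)\<^sup>2 + (g x)\<^sup>2" for x
    using sum_squares_bound[of "\<bar>f x\<bar>" "\<bar>g x\<bar>"]
      mult_nonneg_nonneg[OF abs_ge_zero[of "f x"] abs_ge_zero[of "g x"]]
    unfolding abs_mult power2_abs mult.assoc by linarith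
  then show "AE x in lebesgue_on {a..b}. norm (f x * g x) \<le> norm ((f x)\<^sup>2 + (g x)\<^sup>2)"
    by (intro AE_I2) (simp add: abs_of_nonneg)
qed

lemma continuous_imp_L2:
  assumes "continuous_on {a..b} f"
  shows "L2 a b f"
  unfolding L2_def using assms
  by (auto intro!: continuous_imp_integrable_real borel_measurable_integrable continuous_intros)

lemma L2_imp_integrable:
  assumes "L2 a b f"
  shows "integrable (lebesgue_on {a..b}) f"
  using L2_integrable_mult[OF assms continuous_imp_L2[of a b "\<lambda>_. 1"]] by simp

lemma L2_lincomb:
  assumes "L2 a b f" "L2 a b g"
  shows "L2 a b (\<lambda>x. f x + c * g x)"
proof -
  have "(f x + c * g x)\<^sup>2 = f x * f x + 2 * c * (f x * g x) + c\<^sup>2 * (g x * g x)" for x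
    by (simp add: power2_eq_square algebra_simps)
  moreover have "(\<lambda>x. f x + c * g x) \<in> borel_measurable (lebesgue_on {a..b})"
    using assms by (auto simp: L2_def)
  ultimately show ?thesis
    using L2_integrable_mult[OF assms(1) assms(1)] L2_integrable_mult[OF assms(2) assms(2)]
      L2_integrable_mult[OF assms]
    by (auto simp: L2_def)
qed

lemma L2_diff: "L2 a b f \<Longrightarrow> L2 a b g \<Longrightarrow> L2 a b (\<lambda>x. f x - g x)"
  using L2_lincomb[of a b f g "-1"] by simp

lemma L2_inner_commute: "L2_inner a b f g = L2_inner a b g f"
  by (simp add: L2_inner_def mult.commute)

lemma L2_inner_diff_left:
  assumes "L2 a b f" "L2 a b g" "L2 a b h"
  shows "L2_inner a b (\<lambda>x. f x - g x) h = L2_inner a b f h - L2_inner a b g h"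
  unfolding L2_inner_def
  using L2_integrable_mult[OF assms(1,3)] L2_integrable_mult[OF assms(2,3)]
  by (simp add: left_diff_distrib)

lemma L2_inner_diff_right:
  assumes "L2 a b f" "L2 a b g" "L2 a b h"
  shows "L2_inner a b h (\<lambda>x. f x - g x) = L2_inner a b h f - L2_inner a b h g"
  using L2_inner_diff_left[OF assms] by (simp add: L2_inner_commute)

lemma L2_cong: "(\<And>x. x \<in> {a..b} \<Longrightarrow> f x = g x) \<Longrightarrow> L2 a b f \<longleftrightarrow> L2 a b g"
  unfolding L2_def using measurable_lebesgue_cong[of "{a..b}" f g borel]
    Bochner_Integration.integrable_cong[OF refl, of "lebesgue_on {a..b}" "\<lambda>x. (f x)\<^sup>2" "\<lambda>x. (g x)\<^sup>2"]
  by simp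

lemma L2_inner_lincomb_right:
  assumes "L2 a b w" "L2 a b f" "L2 a b g"
  shows "L2_inner a b w (\<lambda>x. f x + k * g x) = L2_inner a b w f + k * L2_inner a b w g"
proof -
  have "L2_inner a b w (\<lambda>x. f x + k * g x) = (LINT x|lebesgue_on {a..b}. w x * f x + k * (w x * g x))"
    by (simp add: L2_inner_def algebra_simps)
  also have "\<dots> = L2_inner a b w f + k * L2_inner a b w g"
    using L2_integrable_mult[OF assms(1,2)] L2_integrable_mult[OF assms(1,3)]
    by (simp add: L2_inner_def)
  finally show ?thesis .
qed

lemma L2_inner_lincomb_left:
  assumes "L2 a b w" "L2 a b f" "L2 a b g"
  shows "L2_inner a b (\<lambda>x. f x + k * g x) w = L2_inner a b f w + k * L2_inner a b g w"
  using L2_inner_lincomb_right[OF assms] by (simp add: L2_inner_commute)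

lemma L2_inner_self_eq_0D:
  assumes "L2 a b f" "L2_inner a b f f = 0"
  shows "L2_eq a b f (\<lambda>x. 0)"
proof -
  have "AE x in lebesgue_on {a..b}. f x * f x = 0"
    using assms integral_nonneg_eq_0_iff_AE[OF L2_integrable_mult[OF assms(1,1)]]
    by (simp add: L2_inner_def)
  then show ?thesis by (simp add: L2_eq_def)
qed

text \<open>Testing against \<open>h = f - g\<close> makes the squared norm of the difference
  vanish. Uniqueness of the adjoint and of the gradient both rest on this.\<close>

lemma L2_eq_if_inner_eq:
  assumes "L2 a b f" "L2 a b g" "\<And>h. L2 a b h \<Longrightarrow> L2_inner a b h f = L2_inner a b h g"
  shows "L2_eq a b f g"
proof -
  have d: "L2 a b (\<lambda>x. f x - g x)"
    using assms(1,2) by (rule L2_diff)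
  then have "L2_inner a b (\<lambda>x. f x - g x) (\<lambda>x. f x - g x) = 0"
    using L2_inner_diff_right[OF assms(1,2) d] assms(3)[OF d] by simp
  then show ?thesis
    using L2_inner_self_eq_0D[OF d] by (simp add: L2_eq_def)
qed

section \<open>Functions whose integrals over intervals vanish\<close>

lemma AE_lebesgue_on_neq: "AE x in lebesgue_on S. x \<noteq> (c::real)" if "S \<in> sets lebesgue"
proof -
  have "AE x in lebesgue. x \<noteq> c"
    using AE_completion[OF AE_lborel_singleton[of c]] by simp
  then show ?thesis
    using that by (auto simp: AE_restrict_space_iff elim: eventually_mono)
qed

text \<open>Dynkin argument: open intervals are stable under intersection and generate the Borel
  sets, and the sets over which \<open>w\<close> integrates to 0 are closed under complements and
  countable disjoint unions. Lebesgue sets differ from Borel sets by null sets, and a density is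
  determined by its integrals over measurable sets.\<close>

lemma AE_zero_if_interval_integrals_zero:
  fixes w :: "real \<Rightarrow> real"
  assumes w: "integrable (lebesgue_on {a..b}) w"
    and zero: "\<And>c d. a \<le> c \<Longrightarrow> c < d \<Longrightarrow> d \<le> b \<Longrightarrow>
      (LINT x|lebesgue_on {a..b}. indicator {c<..<d} x * w x) = 0"
  shows "AE x in lebesgue_on {a..b}. w x = 0"
proof (rule density_unique_real[OF w])
  let ?M = "lebesgue_on {a..b}"
  have borel_sets: "sets (borel :: real measure) = sigma_sets UNIV (range (\<lambda>(c, d). {c<..<d}))"
  proof -
    have "(\<lambda>(c, d). box c d) = (\<lambda>(c :: real, d). {c<..<d})"
      by auto
    then show ?thesis
      by (simp only: borel_eq_box[where 'a=real] sets_measure_of Pow_UNIV subset_UNIV)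
  qed
  have ne: "AE x in ?M. x \<noteq> a \<and> x \<noteq> b"
    by (simp add: AE_lebesgue_on_neq)
  have sets: "A \<in> sets borel \<Longrightarrow> indicat_real A \<in> borel_measurable ?M" for A :: "real set"
    by (intro measurable_restrict_space1 borel_measurable_indicator) simp
  have int: "integrable ?M (\<lambda>x. indicator A x * w x)" if "A \<in> sets borel" for A :: "real set"
  proof (rule Bochner_Integration.integrable_bound[OF w])
    show "(\<lambda>x. indicator A x * w x) \<in> borel_measurable ?M"
      by (intro borel_measurable_times sets that borel_measurable_integrable w)
    show "AE x in ?M. norm (indicator A x * w x) \<le> norm (w x)"
      by (intro AE_I2) (simp add: indicator_def)
  qed
  \<comment> \<open>The hypothesis covers only intervals inside \<open>{a..b}\<close>. Any other
    open interval is clipped to \<open>{a<..<b}\<close>, which changes its trace on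
    \<open>{a..b}\<close> by endpoints at most; if nothing remains, the trace is a null set.\<close>
  have box: "(LINT x|?M. indicator {c<..<d} x * w x) = 0" for c d
  proof (cases "max c a < min d b")
    case True
    have "(LINT x|?M. indicator {c<..<d} x * w x)
        = (LINT x|?M. indicator {max c a<..<min d b} x * w x)"
    proof (rule Bochner_Integration.integral_cong_AE)
      show "AE x in ?M. indicator {c<..<d} x * w x = indicator {max c a<..<min d b} x * w x"
        by (rule lebesgue_on_mono[OF ne]) (auto simp: indicator_def)
    qed (intro borel_measurable_integrable int; simp)+
    then show ?thesis
      using zero[of "max c a" "min d b"] True by simp
  next
    case False
    show ?thesis
      by (rule integral_eq_zero_AE, rule lebesgue_on_mono[OF ne])
        (use False in \<open>auto simp: indicator_def max_def min_def split: if_splits\<close>)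
  qed
  have stable: "Int_stable (range (\<lambda>(c::real, d). {c<..<d}))"
    by (auto simp: Int_stable_def)
  have subset_Pow: "range (\<lambda>(c::real, d). {c<..<d}) \<subseteq> Pow UNIV"
    by simp
  have borel: "(LINT x|?M. indicator A x * w x) = 0"
    if "A \<in> sigma_sets UNIV (range (\<lambda>(c::real, d). {c<..<d}))" for A
    using that
  proof (induction rule: sigma_sets_induct_disjoint[OF stable subset_Pow, consumes 1, case_names basic empty compl union])
    case (basic A)
    then show ?case using box by auto
  next
    case (compl A)
    have A: "A \<in> sets borel"
      using compl(1) by (simp add: borel_sets)
    \<comment> \<open>Closure under complements needs the integral over the whole space; an open
      interval that contains \<open>{a..b}\<close> provides it.\<close>
    have all: "(LINT x|?M. w x) = 0"
      using box[of "a - 1" "b + 1"]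
      by (subst Bochner_Integration.integral_cong[OF refl, of _ _ "\<lambda>x. indicator {a-1<..<b+1} x * w x"]) auto
    have "(LINT x|?M. indicator (UNIV - A) x * w x) = (LINT x|?M. w x - indicator A x * w x)"
      by (intro Bochner_Integration.integral_cong) (auto simp: indicator_def)
    also have "\<dots> = 0"
      using w int[OF A] all compl(2) by simp
    finally show ?case .
  next
    case (union A)
    have A: "A i \<in> sets borel" for i
      using union(2) by (auto simp: borel_sets)
    \<comment> \<open>Finite partial unions have integral 0 by disjointness, and dominated
      convergence with bound \<open>norm (w x)\<close> passes to the countable union.\<close>
    have "(\<lambda>n. LINT x|?M. indicator (\<Union>i<n. A i) x * w x) \<longlonglongrightarrow>
        (LINT x|?M. indicator (\<Union>i. A i) x * w x)"
    proof (rule integral_dominated_convergence[where w="\<lambda>x. norm (w x)"])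
      show "AE x in ?M. (\<lambda>n. indicator (\<Union>i<n. A i) x * w x) \<longlonglongrightarrow> indicator (\<Union>i. A i) x * w x"
      proof (rule AE_I2)
        fix x
        have "(\<lambda>n. indicator (\<Union>i<n. A i) x) \<longlonglongrightarrow> (indicator (\<Union>i. A i) x :: real)"
          by (rule LIMSEQ_indicator_UN)
        then show "(\<lambda>n. indicator (\<Union>i<n. A i) x * w x) \<longlonglongrightarrow> indicator (\<Union>i. A i) x * w x"
          by (rule tendsto_mult_right)
      qed
      show "AE x in ?M. norm (indicator (\<Union>i<n. A i) x * w x) \<le> norm (w x)" for n
        by (intro AE_I2) (simp add: indicator_def)
      show "integrable ?M (\<lambda>x. norm (w x))"
        using w by simp
    qed (rule borel_measurable_integrable[OF int], use A in auto)+
    moreover have "(LINT x|?M. indicator (\<Union>i<n. A i) x * w x) = 0" for n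
    proof (induction n)
      case (Suc n)
      have "indicator (\<Union>i<Suc n. A i) x = (indicator (\<Union>i<n. A i) x + indicator (A n) x :: real)" for x
      proof -
        have "x \<notin> A n" if "i < n" "x \<in> A i" for i
          using disjoint_family_onD[OF union(1), of i n] that by auto
        then show ?thesis
          by (auto simp: indicator_def less_Suc_eq)
      qed
      then show ?case
        using int[OF A, of n] int[of "\<Union>i<n. A i"] A Suc union(3)[of n]
        by (auto simp: distrib_right)
    qed simp
    ultimately show ?case
      by (simp add: LIMSEQ_const_iff)
  qed auto
  fix A assume "A \<in> sets ?M"
  then have "A \<in> sets lebesgue" "A \<subseteq> {a..b}"
    by (auto simp: sets_restrict_space)
  \<comment> \<open>Completeness of Lebesgue measure: \<open>A\<close> is a Borel set
    \<open>S\<close> up to a subset of the null set \<open>N'\<close>, so both have the same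
    integral of \<open>w\<close>.\<close>
  then obtain S N N' where S: "A = S \<union> N" "N \<subseteq> N'" "N' \<in> null_sets lborel" "S \<in> sets lborel"
    by (metis sets_completionE)
  have "AE x in lborel. x \<notin> N'"
    using S(3) by (rule AE_not_in)
  then have "AE x in lebesgue. x \<notin> N'"
    by (rule AE_completion)
  then have N': "AE x in ?M. x \<notin> N'"
    by (auto simp: AE_restrict_space_iff elim: eventually_mono)
  have "set_lebesgue_integral ?M A w = (LINT x|?M. indicator S x * w x)"
    unfolding set_lebesgue_integral_def real_scaleR_def
  proof (rule Bochner_Integration.integral_cong_AE)
    show "AE x in ?M. indicator A x * w x = indicator S x * w x"
      by (rule lebesgue_on_mono[OF N']) (use S in \<open>auto simp: indicator_def\<close>)
    show "(\<lambda>x. indicator A x * w x) \<in> borel_measurable ?M"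
      using w \<open>A \<in> sets ?M\<close>
      by (intro borel_measurable_times borel_measurable_indicator borel_measurable_integrable)
    show "(\<lambda>x. indicator S x * w x) \<in> borel_measurable ?M"
      using S(4) by (intro borel_measurable_integrable int) simp
  qed
  also have "\<dots> = 0"
    using borel S(4) by (simp add: borel_sets)
  finally show "set_lebesgue_integral ?M A w = set_lebesgue_integral ?M A (\<lambda>_. 0)"
    by (simp add: set_lebesgue_integral_def)
qed simp

section \<open>Calculus with Lebesgue integrals of continuous functions\<close>

lemma LINT_FTC:
  fixes F f :: "real \<Rightarrow> real"
  assumes "a \<le> b" "continuous_on {a..b} f"
    and "\<And>x. x \<in> {a..b} \<Longrightarrow> (F has_real_derivative f x) (at x within {a..b})"
  shows "(LINT x|lebesgue_on {a..b}. f x) = F b - F a"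
proof -
  have "(f has_integral F b - F a) {a..b}"
    using assms by (intro fundamental_theorem_of_calculus)
      (auto simp: has_real_derivative_iff_has_vector_derivative)
  then show ?thesis
    using assms by (simp add: lebesgue_integral_eq_integral continuous_imp_integrable_real integral_unique)
qed

lemma LINT_by_parts:
  fixes F G f g :: "real \<Rightarrow> real"
  assumes "a \<le> b" "continuous_on {a..b} f" "continuous_on {a..b} g"
    and F: "\<And>x. x \<in> {a..b} \<Longrightarrow> (F has_real_derivative f x) (at x within {a..b})"
    and G: "\<And>x. x \<in> {a..b} \<Longrightarrow> (G has_real_derivative g x) (at x within {a..b})"
  shows "(LINT x|lebesgue_on {a..b}. F x * g x)
    = F b * G b - F a * G a - (LINT x|lebesgue_on {a..b}. f x * G x)"
proof -
  have FG: "continuous_on {a..b} F" "continuous_on {a..b} G"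
    by (rule DERIV_continuous_on[OF F] DERIV_continuous_on[OF G], assumption)+
  have "(LINT x|lebesgue_on {a..b}. f x * G x + F x * g x) = F b * G b - F a * G a"
    by (rule LINT_FTC)
      (use assms(1-3) FG DERIV_mult[OF F G] in \<open>auto intro!: continuous_intros simp: mult.commute\<close>)
  moreover have "(LINT x|lebesgue_on {a..b}. f x * G x + F x * g x)
      = (LINT x|lebesgue_on {a..b}. f x * G x) + (LINT x|lebesgue_on {a..b}. F x * g x)"
    by (intro Bochner_Integration.integral_add continuous_imp_integrable_real continuous_intros assms FG)
  ultimately show ?thesis by simp
qed

lemma LINT_nonneg_eq_0D:
  fixes f :: "real \<Rightarrow> real"
  assumes "continuous_on {a..b} f" "\<And>x. x \<in> {a..b} \<Longrightarrow> 0 \<le> f x"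
    and "(LINT x|lebesgue_on {a..b}. f x) = 0" "a < b" "x \<in> {a..b}"
  shows "f x = 0"
  using integral_eq_0_iff[OF assms(1)] assms
  by (simp add: lebesgue_integral_eq_integral continuous_imp_integrable_real)

text \<open>The continuous nonnegative function \<open>(f x - g x)\<^sup>2\<close> has integral 0,
  hence vanishes everywhere on the interval, endpoints included.\<close>

lemma AE_eq_continuous_imp_eq:
  fixes f g :: "real \<Rightarrow> real"
  assumes "a < b" "continuous_on {a..b} f" "continuous_on {a..b} g"
    and "AE x in lebesgue_on {a..b}. f x = g x" "x \<in> {a..b}"
  shows "f x = g x"
proof -
  have "(LINT x|lebesgue_on {a..b}. (f x - g x)\<^sup>2) = 0"
    by (rule integral_eq_zero_AE) (use assms(4) in \<open>auto elim: eventually_mono\<close>)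
  then have "(f x - g x)\<^sup>2 = 0"
    by (intro LINT_nonneg_eq_0D[where f="\<lambda>x. (f x - g x)\<^sup>2"])
      (use assms in \<open>auto intro!: continuous_intros\<close>)
  then show ?thesis by simp
qed

section \<open>Test functions and the lemma of du Bois-Reymond\<close>

definition smooth :: "(real \<Rightarrow> real) \<Rightarrow> bool" where
  "smooth f \<longleftrightarrow> (\<forall>n x. (deriv ^^ n) f field_differentiable (at x))"

text \<open>By induction on \<open>n\<close>, every iterated derivative stays in a class that is
  closed under differentiation. Smoothness is thus proved by exhibiting an invariant class instead
  of a formula for the \<open>n\<close>-th derivative.\<close>

lemma smooth_coinduct:
  assumes "P f" and step: "\<And>f. P f \<Longrightarrow> \<exists>f'. P f' \<and> (\<forall>x. (f has_real_derivative f' x) (at x))"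
  shows "smooth f"
proof -
  have P: "P ((deriv ^^ n) f)" for n
  proof (induction n)
    case (Suc n)
    then obtain f' where f': "P f'" "\<And>x. ((deriv ^^ n) f has_real_derivative f' x) (at x)"
      using step by blast
    then have "deriv ((deriv ^^ n) f) = f'"
      by (auto simp: DERIV_imp_deriv)
    then show ?case using f'(1) by simp
  qed (simp add: assms(1))
  show ?thesis
    unfolding smooth_def field_differentiable_def using step[OF P] by blast
qed

lemma smooth_deriv: "smooth f \<Longrightarrow> smooth (deriv f)"
  unfolding smooth_def by (metis comp_apply funpow_Suc_right)

lemma smooth_DERIV: "smooth f \<Longrightarrow> (f has_real_derivative deriv f x) (at x)"
  unfolding smooth_def by (metis field_differentiable_derivI funpow_0)

lemma smooth_antideriv:
  assumes "smooth f" "\<And>x. (F has_real_derivative f x) (at x)"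
  shows "smooth F"
  by (rule smooth_coinduct[where P="\<lambda>h. smooth h \<or> h = F"])
    (use assms smooth_deriv smooth_DERIV in blast)+

lemma smooth_lincomb:
  assumes "smooth f" "smooth g"
  shows "smooth (\<lambda>x. f x + c * g x)"
proof (rule smooth_coinduct[where P="\<lambda>h. \<exists>f g. smooth f \<and> smooth g \<and> h = (\<lambda>x. f x + c * g x)"])
  fix h assume "\<exists>f g. smooth f \<and> smooth g \<and> h = (\<lambda>x. f x + c * g x)"
  then obtain f g where h: "smooth f" "smooth g" "h = (\<lambda>x. f x + c * g x)"
    by blast
  then have "(h has_real_derivative deriv f x + c * deriv g x) (at x)" for x
    by (auto intro!: derivative_eq_intros smooth_DERIV)
  then show "\<exists>h'. (\<exists>f g. smooth f \<and> smooth g \<and> h' = (\<lambda>x. f x + c * g x)) \<and>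
      (\<forall>x. (h has_real_derivative h' x) (at x))"
    using h smooth_deriv by blast
qed (use assms in blast)

text \<open>
  Derivatives of \<open>exp (- s / x)\<close> stay in the span of these functions; the power of \<open>1 / x\<close> is what
  makes the family closed under differentiation.
\<close>

definition flat_exp :: "real \<Rightarrow> nat \<Rightarrow> real \<Rightarrow> real" where
  "flat_exp s i x = (if 0 < x then exp (- s / x) / x ^ i else 0)"

text \<open>From the right, substituting \<open>y = s / x\<close> turns the function into
  \<open>y ^ i / exp y / s ^ i\<close> with \<open>y\<close> tending to infinity; from the left it
  is constantly 0.\<close>

lemma flat_exp_tendsto_0:
  assumes "0 < s"
  shows "(flat_exp s i \<longlongrightarrow> 0) (at 0)"
proof -
  have "((\<lambda>y. (y ^ i / exp y) / s ^ i) \<longlongrightarrow> 0 / s ^ i) at_top"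
    by (intro tendsto_divide tendsto_power_div_exp_0 tendsto_const) (use assms in simp)
  moreover have "filterlim (\<lambda>x. s / x) at_top (at_right 0)"
    using filterlim_tendsto_pos_mult_at_top[OF tendsto_const assms filterlim_inverse_at_top_right]
    by (simp add: divide_inverse)
  ultimately have "((\<lambda>x. ((s / x) ^ i / exp (s / x)) / s ^ i) \<longlongrightarrow> 0 / s ^ i) (at_right 0)"
    by (rule filterlim_compose)
  moreover have "\<forall>\<^sub>F x in at_right 0. ((s / x) ^ i / exp (s / x)) / s ^ i = flat_exp s i x"
    by (rule eventually_mono[OF eventually_at_right_less])
      (use assms in \<open>auto simp: flat_exp_def power_divide exp_minus field_simps\<close>)
  ultimately have "(flat_exp s i \<longlongrightarrow> 0) (at_right 0)"
    using tendsto_cong by force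
  moreover have "(flat_exp s i \<longlongrightarrow> 0) (at_left 0)"
    by (rule tendsto_eventually) (auto simp: flat_exp_def eventually_at_filter)
  ultimately show ?thesis
    by (simp add: filterlim_split_at)
qed

lemma flat_exp_DERIV:
  assumes "0 < s"
  shows "(flat_exp s i has_real_derivative s * flat_exp s (i + 2) x - i * flat_exp s (i + 1) x) (at x)"
proof -
  consider "x > 0" | "x < 0" | "x = 0" by linarith
  then show ?thesis
  proof cases
    case 1
    have "((\<lambda>x. exp (- s / x) / x ^ i) has_real_derivative
        (exp (- s / x) * (s / x\<^sup>2) * x ^ i - exp (- s / x) * (i * x ^ (i - 1))) / (x ^ i * x ^ i)) (at x)"
      using 1 by (auto intro!: derivative_eq_intros simp: power2_eq_square)
    moreover have "(exp (- s / x) * (s / x\<^sup>2) * x ^ i - exp (- s / x) * (i * x ^ (i - 1))) / (x ^ i * x ^ i)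
        = s * flat_exp s (i + 2) x - i * flat_exp s (i + 1) x"
    proof -
      \<comment> \<open>The exponential is abstracted to \<open>E\<close>, leaving a rational
        identity. The case split on \<open>i\<close> resolves the truncated subtraction
        \<open>i - 1\<close>.\<close>
      have "(E * (s / x\<^sup>2) * x ^ i - E * (i * x ^ (i - 1))) / (x ^ i * x ^ i)
          = s * (E / x ^ (i + 2)) - i * (E / x ^ (i + 1))" for E :: real
        using 1 by (cases i) (simp_all add: field_simps power2_eq_square)
      then show ?thesis
        using 1 by (simp only: flat_exp_def if_True)
    qed
    ultimately have "((\<lambda>x. exp (- s / x) / x ^ i) has_real_derivative
        s * flat_exp s (i + 2) x - i * flat_exp s (i + 1) x) (at x)"
      by simp
    then show ?thesis
      by (rule has_field_derivative_transform_within_open[where S="{0<..}"])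
        (use 1 in \<open>auto simp: flat_exp_def\<close>)
  next
    case 2
    show ?thesis
      by (rule has_field_derivative_transform_within_open[where S="{..<0}" and f="\<lambda>_. 0"])
        (use 2 in \<open>auto simp: flat_exp_def\<close>)
  next
    case 3
    \<comment> \<open>At the origin the difference quotient is the next member of the family, which
      tends to 0. Equality also holds at \<open>h = 0\<close>, where both sides are 0.\<close>
    have "(\<lambda>h. (flat_exp s i (0 + h) - flat_exp s i 0) / h) = flat_exp s (i + 1)"
      by (auto simp: flat_exp_def)
    then show ?thesis
      using 3 flat_exp_tendsto_0[OF assms, of "i + 1"]
      by (simp add: DERIV_def flat_exp_def)
  qed
qed

text \<open>The invariant class for coinduction: one factor is flat at \<open>c\<close>, the other
  at \<open>d\<close>. The coefficient \<open>k\<close> sits in the monomials, so closure under sums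
  already yields the whole linear span.\<close>

inductive flat_span :: "real \<Rightarrow> real \<Rightarrow> real \<Rightarrow> (real \<Rightarrow> real) \<Rightarrow> bool" for s c d where
  monomial: "flat_span s c d (\<lambda>x. k * flat_exp s i (x - c) * flat_exp s j (d - x))"
| add: "flat_span s c d f \<Longrightarrow> flat_span s c d g \<Longrightarrow> flat_span s c d (\<lambda>x. f x + g x)"

lemma flat_span_deriv:
  assumes "0 < s" "flat_span s c d f"
  shows "\<exists>f'. flat_span s c d f' \<and> (\<forall>x. (f has_real_derivative f' x) (at x))"
  using assms(2)
proof induction
  case (monomial k i j)
  let ?m = "\<lambda>k i j x. k * flat_exp s i (x - c) * flat_exp s j (d - x)"
  let ?f' = "\<lambda>x. (?m (k * s) (i + 2) j x + ?m (- k * i) (i + 1) j x)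
    + (?m (- k * s) i (j + 2) x + ?m (k * j) i (j + 1) x)"
  have "flat_span s c d ?f'"
    by (intro flat_span.intros)
  moreover have "(?m k i j has_real_derivative ?f' x) (at x)" for x
    by (rule derivative_eq_intros DERIV_chain2[OF flat_exp_DERIV[OF assms(1)]] refl
        | simp add: algebra_simps)+
  ultimately show ?case by blast
next
  case (add f g)
  then obtain f' g' where "flat_span s c d f'" "flat_span s c d g'"
    "\<And>x. (f has_real_derivative f' x) (at x)" "\<And>x. (g has_real_derivative g' x) (at x)"
    by blast
  then show ?case
    by (intro exI[of _ "\<lambda>x. f' x + g' x"]) (auto intro: flat_span.add derivative_intros)
qed

text \<open>On \<open>{c<..<d}\<close> this is \<open>exp (- s / (x - c) - s / (d - x))\<close>, and
  it is 0 elsewhere. The parameter \<open>s\<close> controls the steepness: as \<open>s\<close>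
  tends to 0 the bump tends to the indicator of \<open>{c<..<d}\<close>.\<close>

definition bump :: "real \<Rightarrow> real \<Rightarrow> real \<Rightarrow> real \<Rightarrow> real" where
  "bump s c d x = flat_exp s 0 (x - c) * flat_exp s 0 (d - x)"

lemma smooth_bump: "0 < s \<Longrightarrow> smooth (bump s c d)"
  using flat_span.monomial[of s c d 1 0 0] flat_span_deriv
  by (intro smooth_coinduct[where P="flat_span s c d"]) (auto simp: bump_def[abs_def])

lemma bump_inside: "c < x \<Longrightarrow> x < d \<Longrightarrow> bump s c d x = exp (- s / (x - c) - s / (d - x))"
  by (simp add: bump_def flat_exp_def exp_add[symmetric])

lemma bump_outside: "x \<notin> {c<..<d} \<Longrightarrow> bump s c d x = 0"
  by (auto simp: bump_def flat_exp_def)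

lemma bump_nonneg: "0 \<le> bump s c d x"
  by (simp add: bump_def flat_exp_def)

lemma bump_le_1: "0 < s \<Longrightarrow> bump s c d x \<le> 1"
  by (auto simp: bump_def flat_exp_def intro!: mult_le_one)

section \<open>Test functions\<close>

lemma test_function_iff: "test_function a b \<phi> \<longleftrightarrow> smooth \<phi> \<and> closure {x. \<phi> x \<noteq> 0} \<subseteq> {a<..<b}"
  by (simp add: test_function_def smooth_def)

lemma test_functionI:
  assumes "smooth \<phi>" "a < c" "d < b" "\<And>x. x \<notin> {c..d} \<Longrightarrow> \<phi> x = 0"
  shows "test_function a b \<phi>"
proof -
  have "closure {x. \<phi> x \<noteq> 0} \<subseteq> {c..d}"
    by (rule closure_minimal) (use assms(4) in blast, simp)
  then show ?thesis
    using assms by (force simp: test_function_iff)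
qed

text \<open>The support is compact, so it attains a minimum and a maximum, and these lie strictly
  inside the interval.\<close>

lemma test_functionE:
  assumes "test_function a b \<phi>" "a < b"
  obtains c d where "a < c" "c \<le> d" "d < b" "\<And>x. x \<notin> {c..d} \<Longrightarrow> \<phi> x = 0"
proof (cases "{x. \<phi> x \<noteq> 0} = {}")
  case True
  then show ?thesis
    \<comment> \<open>The zero function has empty support; the midpoint serves as a degenerate
      interval.\<close>
    using that[of "(a + b) / 2" "(a + b) / 2"] assms(2) by auto
next
  case False
  let ?K = "closure {x. \<phi> x \<noteq> 0}"
  have K: "?K \<subseteq> {a<..<b}"
    using assms by (simp add: test_function_iff)
  then have "bounded ?K"
    by (intro bounded_subset[OF compact_imp_bounded[OF compact_Icc[of a b]]]) auto
  then have "compact ?K"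
    by (simp add: compact_eq_bounded_closed)
  moreover have "?K \<noteq> {}"
    using False by simp
  ultimately obtain c d where cd: "c \<in> ?K" "\<forall>x\<in>?K. c \<le> x" "d \<in> ?K" "\<forall>x\<in>?K. x \<le> d"
    using compact_attains_inf[of ?K] compact_attains_sup[of ?K] by auto
  have "\<phi> x = 0" if "x \<notin> {c..d}" for x
  proof (rule ccontr)
    assume "\<phi> x \<noteq> 0"
    then have "x \<in> ?K"
      using closure_subset[of "{x. \<phi> x \<noteq> 0}"] by blast
    then show False
      using cd that by auto
  qed
  moreover have "a < c" "d < b"
    using K cd(1,3) by auto
  ultimately show ?thesis
    using that[of c d] cd(1,4) by blast
qed

lemma test_function_bump: "0 < s \<Longrightarrow> a < c \<Longrightarrow> d < b \<Longrightarrow> test_function a b (bump s c d)"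
  by (rule test_functionI[of _ _ c d]) (auto simp: smooth_bump bump_outside)

lemma test_function_lincomb:
  assumes "test_function a b \<phi>" "test_function a b \<psi>" "a < b"
  shows "test_function a b (\<lambda>x. \<phi> x + k * \<psi> x)"
proof -
  obtain c d where cd: "a < c" "d < b" "\<And>x. x \<notin> {c..d} \<Longrightarrow> \<phi> x = 0"
    using assms test_functionE by metis
  obtain c' d' where cd': "a < c'" "d' < b" "\<And>x. x \<notin> {c'..d'} \<Longrightarrow> \<psi> x = 0"
    using assms test_functionE by metis
  show ?thesis
    by (rule test_functionI[of _ _ "min c c'" "max d d'"])
      (use assms cd(1,2) cd'(1,2) smooth_lincomb cd(3) cd'(3) in \<open>auto simp: test_function_iff not_le\<close>)
qed

text \<open>The function is locally 0 on the open complement of its support, so the derivative is 0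
  there and the support does not grow.\<close>

lemma test_function_deriv:
  assumes "test_function a b \<phi>"
  shows "test_function a b (deriv \<phi>)"
proof -
  have "deriv \<phi> x = 0" if "x \<notin> closure {x. \<phi> x \<noteq> 0}" for x
  proof (rule DERIV_imp_deriv)
    show "(\<phi> has_real_derivative 0) (at x)"
      by (rule has_field_derivative_transform_within_open[where f="\<lambda>_. 0" and S="- closure {x. \<phi> x \<noteq> 0}"])
        (use that closure_subset[of "{x. \<phi> x \<noteq> 0}"] in auto)
  qed
  then have "closure {x. deriv \<phi> x \<noteq> 0} \<subseteq> closure {x. \<phi> x \<noteq> 0}"
    by (intro closure_minimal) auto
  then show ?thesis
    using assms by (auto simp: test_function_iff smooth_deriv)
qed

lemma test_function_continuous: "test_function a b \<phi> \<Longrightarrow> continuous_on S \<phi>"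
  using smooth_DERIV DERIV_continuous_on by (metis test_function_iff DERIV_subset subset_UNIV)

lemma test_function_L2: "test_function a b \<phi> \<Longrightarrow> L2 a b \<phi>"
  by (simp add: continuous_imp_L2 test_function_continuous)

lemma test_function_DERIV: "test_function a b \<phi> \<Longrightarrow> (\<phi> has_real_derivative deriv \<phi> x) (at x within S)"
  using smooth_DERIV DERIV_subset by (metis test_function_iff subset_UNIV)

lemma test_function_boundary:
  assumes "test_function a b \<phi>"
  shows "\<phi> a = 0" "\<phi> b = 0"
  using assms closure_subset[of "{x. \<phi> x \<noteq> 0}"] by (auto simp: test_function_iff)

text \<open>The primitive starting at \<open>a\<close> is 0 to the left of the support and constant
  to its right, where mean zero makes the constant 0. So it has compact support as well.\<close>

lemma test_function_antideriv:
  assumes \<psi>: "test_function a b \<psi>" and "a < b" and zero: "(LINT x|lebesgue_on {a..b}. \<psi> x) = 0"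
  obtains \<phi> where "test_function a b \<phi>" "deriv \<phi> = \<psi>"
proof -
  obtain c d where cd: "a < c" "c \<le> d" "d < b" "\<And>x. x \<notin> {c..d} \<Longrightarrow> \<psi> x = 0"
    using test_functionE[OF \<psi> \<open>a < b\<close>] by metis
  note cont = test_function_continuous[OF \<psi>]
  define \<phi> where "\<phi> x = integral {a..x} \<psi>" for x
  have \<phi>_left: "\<phi> x = 0" if "x < c" for x
    unfolding \<phi>_def using cd that by (subst integral_cong[where g="\<lambda>_. 0"]) auto
  have \<phi>_const: "\<phi> x = \<phi> d" if "d \<le> x" for x
  proof -
    have "integral {a..d} \<psi> + integral {d..x} \<psi> = integral {a..x} \<psi>"
      by (rule Henstock_Kurzweil_Integration.integral_combine)
        (use cd that in \<open>auto intro: integrable_continuous_real cont\<close>)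
    moreover have "integral {d..x} \<psi> = integral {d..x} (\<lambda>_. 0)"
      by (rule integral_spike[of "{d}"]) (use cd in auto)
    ultimately show ?thesis by (simp add: \<phi>_def)
  qed
  have "\<phi> b = 0"
    using zero by (simp add: \<phi>_def lebesgue_integral_eq_integral continuous_imp_integrable_real cont)
  then have \<phi>_right: "\<phi> x = 0" if "d \<le> x" for x
    using \<phi>_const[of b] \<phi>_const[OF that] cd by simp
  have deriv: "(\<phi> has_real_derivative \<psi> x) (at x)" for x
  proof (cases "x < c")
    case True
    then have "\<psi> x = 0" using cd by simp
    show ?thesis
      by (rule has_field_derivative_transform_within_open[where f="\<lambda>_. 0" and S="{..<c}"])
        (use True \<open>\<psi> x = 0\<close> \<phi>_left in auto)
  next
    case False
    have "(\<phi> has_real_derivative \<psi> x) (at x within {a..x + 1})"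
      unfolding \<phi>_def[abs_def] by (rule integral_has_real_derivative) (use False cd cont in auto)
    then show ?thesis
      using False cd at_within_Icc_at[of a x "x + 1"] by simp
  qed
  then have "smooth \<phi>"
    using smooth_antideriv \<psi> test_function_iff by blast
  then have "test_function a b \<phi>"
    by (rule test_functionI[of _ _ c d]) (use cd \<phi>_left \<phi>_right in auto)
  moreover have "deriv \<phi> = \<psi>"
    using deriv by (auto simp: DERIV_imp_deriv)
  ultimately show ?thesis by (rule that)
qed

text \<open>Bumps between 0 and 1 converge pointwise to the indicator of a given open subinterval.
  Dominated convergence shows that \<open>w\<close> integrates to 0 over each of these.\<close>

lemma fundamental_lemma:
  assumes w: "integrable (lebesgue_on {a..b}) w"
    and orth: "\<And>\<phi>. test_function a b \<phi> \<Longrightarrow> L2_inner a b w \<phi> = 0"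
  shows "AE x in lebesgue_on {a..b}. w x = 0"
proof (rule AE_zero_if_interval_integrals_zero[OF w])
  let ?M = "lebesgue_on {a..b}"
  fix c d assume cd: "a \<le> c" "c < d" "d \<le> b"
  \<comment> \<open>\<open>e n\<close> acts twice: it shrinks the interval, so that the bump is a
    test function even if \<open>c = a\<close> or \<open>d = b\<close>, and as steepness parameter
    it lets the bump rise to 1. If the shrunken interval is empty, the bump is simply 0.\<close>
  define e where "e n = 1 / real (Suc n)" for n
  define \<phi> where "\<phi> n = bump (e n) (c + e n) (d - e n)" for n
  have e: "0 < e n" for n by (simp add: e_def)
  have e_lim: "e \<longlonglongrightarrow> 0"
    unfolding e_def[abs_def] by (rule LIMSEQ_Suc[OF lim_const_over_n])
  have test: "test_function a b (\<phi> n)" for n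
    using e[of n] cd unfolding \<phi>_def by (intro test_function_bump) auto
  have lim: "(\<lambda>n. \<phi> n x) \<longlonglongrightarrow> indicator {c<..<d} x" for x
  proof (cases "x \<in> {c<..<d}")
    case True
    have "\<forall>\<^sub>F n in sequentially. e n < x - c" "\<forall>\<^sub>F n in sequentially. e n < d - x"
      using True by (auto intro!: order_tendstoD(2)[OF e_lim])
    then have "\<forall>\<^sub>F n in sequentially.
        exp (- e n / (x - (c + e n)) - e n / (d - e n - x)) = \<phi> n x"
      by eventually_elim (simp add: \<phi>_def bump_inside)
    moreover have "(\<lambda>n. exp (- e n / (x - (c + e n)) - e n / (d - e n - x))) \<longlonglongrightarrow>
        exp (- 0 / (x - (c + 0)) - 0 / (d - 0 - x))"
      by (intro tendsto_intros e_lim) (use True in auto)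
    ultimately show ?thesis
      using True tendsto_cong by force
  next
    case False
    then have "\<phi> n x = 0" for n
      unfolding \<phi>_def using e[of n] by (intro bump_outside) auto
    then show ?thesis using False by simp
  qed
  have "(\<lambda>n. LINT x|?M. \<phi> n x * w x) \<longlonglongrightarrow> (LINT x|?M. indicator {c<..<d} x * w x)"
  proof (rule integral_dominated_convergence[where w="\<lambda>x. norm (w x)"])
    have meas: "\<phi> n \<in> borel_measurable ?M" for n
      using test_function_L2[OF test] by (simp add: L2_def)
    then show "(\<lambda>x. \<phi> n x * w x) \<in> borel_measurable ?M" for n
      using w by auto
    have "(indicator {c<..<d} :: real \<Rightarrow> real) \<in> borel_measurable ?M"
      by (rule borel_measurable_LIMSEQ_real[OF lim meas])
    then show "(\<lambda>x. indicator {c<..<d} x * w x) \<in> borel_measurable ?M"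
      using w by auto
    show "AE x in ?M. (\<lambda>n. \<phi> n x * w x) \<longlonglongrightarrow> indicator {c<..<d} x * w x"
      by (intro AE_I2 tendsto_mult_right lim)
    show "AE x in ?M. norm (\<phi> n x * w x) \<le> norm (w x)" for n
      using bump_nonneg bump_le_1[OF e]
      by (intro AE_I2) (auto simp: \<phi>_def abs_mult intro!: mult_left_le_one_le)
  qed (use w in auto)
  moreover have "(LINT x|?M. \<phi> n x * w x) = 0" for n
    using orth[OF test] by (simp add: L2_inner_def mult.commute)
  ultimately show "(LINT x|?M. indicator {c<..<d} x * w x) = 0"
    by (simp add: LIMSEQ_const_iff)
qed

text \<open>
  A test function of mean zero is a derivative; subtracting a multiple of a fixed bump reduces every
  test function to this case.
\<close>

lemma functional_vanishing_on_derivatives: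
  assumes "a < b"
    and lin: "\<And>\<phi> \<psi> k. test_function a b \<phi> \<Longrightarrow> test_function a b \<psi> \<Longrightarrow>
      L (\<lambda>x. \<phi> x + k * \<psi> x) = L \<phi> + k * (L \<psi> :: real)"
    and zero: "\<And>\<phi>. test_function a b \<phi> \<Longrightarrow> L (deriv \<phi>) = 0"
  shows "\<exists>C. \<forall>\<phi>. test_function a b \<phi> \<longrightarrow> L \<phi> = C * (LINT x|lebesgue_on {a..b}. \<phi> x)"
proof -
  let ?I = "\<lambda>\<phi>. LINT x|lebesgue_on {a..b}. \<phi> x"
  define c d where "c = (2 * a + b) / 3" and "d = (a + 2 * b) / 3"
  have cd: "a < c" "c < d" "d < b"
    using \<open>a < b\<close> by (auto simp: c_def d_def)
  define \<theta> where "\<theta> = bump 1 c d"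
  have \<theta>: "test_function a b \<theta>"
    using cd by (auto simp: \<theta>_def intro: test_function_bump)
  have "\<theta> ((c + d) / 2) \<noteq> 0"
    unfolding \<theta>_def using cd by (subst bump_inside) auto
  then have I: "?I \<theta> \<noteq> 0"
    using LINT_nonneg_eq_0D[OF test_function_continuous[OF \<theta>] _ _ \<open>a < b\<close>, of "(c + d) / 2"] cd
    by (auto simp: \<theta>_def bump_nonneg)
  show ?thesis
  proof (intro exI[of _ "L \<theta> / ?I \<theta>"] allI impI)
    fix \<psi> assume \<psi>: "test_function a b \<psi>"
    define k where "k = - ?I \<psi> / ?I \<theta>"
    have test: "test_function a b (\<lambda>x. \<psi> x + k * \<theta> x)"
      using \<psi> \<theta> \<open>a < b\<close> by (rule test_function_lincomb)
    have "?I (\<lambda>x. \<psi> x + k * \<theta> x) = ?I \<psi> + k * ?I \<theta>"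
      using L2_imp_integrable[OF test_function_L2[OF \<psi>]] L2_imp_integrable[OF test_function_L2[OF \<theta>]]
      by simp
    also have "\<dots> = 0"
      using I by (simp add: k_def)
    finally obtain \<phi> where "test_function a b \<phi>" "deriv \<phi> = (\<lambda>x. \<psi> x + k * \<theta> x)"
      using test_function_antideriv[OF test \<open>a < b\<close>] by metis
    then have "L \<psi> + k * L \<theta> = 0"
      using zero lin[OF \<psi> \<theta>] by metis
    then show "L \<psi> = L \<theta> / ?I \<theta> * ?I \<psi>"
      by (simp add: k_def)
  qed
qed

text \<open>The functional given by \<open>w\<close> kills derivatives, so it is \<open>C\<close>
  times integration. Hence \<open>w - C\<close> is orthogonal to every test function.\<close>

lemma du_Bois_Reymond:
  assumes "a < b" and w: "L2 a b w"
    and orth: "\<And>\<phi>. test_function a b \<phi> \<Longrightarrow> L2_inner a b w (deriv \<phi>) = 0"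
  shows "\<exists>C. AE x in lebesgue_on {a..b}. w x = C"
proof -
  obtain C where C: "\<And>\<phi>. test_function a b \<phi> \<Longrightarrow>
      L2_inner a b w \<phi> = C * (LINT x|lebesgue_on {a..b}. \<phi> x)"
    using functional_vanishing_on_derivatives[OF \<open>a < b\<close>, of "L2_inner a b w"]
      L2_inner_lincomb_right[OF w test_function_L2 test_function_L2] orth by blast
  have const: "L2 a b (\<lambda>_. C)"
    by (simp add: continuous_imp_L2)
  have "L2_inner a b (\<lambda>x. w x - C) \<phi> = 0" if "test_function a b \<phi>" for \<phi>
    using L2_inner_diff_left[OF w const test_function_L2[OF that]] C[OF that]
    by (simp add: L2_inner_def)
  then have "AE x in lebesgue_on {a..b}. w x - C = 0"
    by (intro fundamental_lemma L2_imp_integrable L2_diff w const)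
  then show ?thesis by auto
qed

text \<open>The functional sending \<open>\<phi>\<close> to the inner product of \<open>w\<close>
  with \<open>deriv \<phi>\<close> kills derivatives, so it is \<open>C\<close> times integration.
  By parts, the identity function paired with \<open>deriv \<phi>\<close> gives minus the integral
  of \<open>\<phi>\<close>; therefore \<open>w x + C * x\<close> falls under the first-order
  lemma.\<close>

lemma du_Bois_Reymond_2:
  assumes "a < b" and w: "L2 a b w"
    and orth: "\<And>\<phi>. test_function a b \<phi> \<Longrightarrow> L2_inner a b w (deriv (deriv \<phi>)) = 0"
  shows "\<exists>C K. AE x in lebesgue_on {a..b}. w x = K + C * x"
proof -
  have deriv_lincomb: "deriv (\<lambda>x. \<phi> x + k * \<psi> x) = (\<lambda>x. deriv \<phi> x + k * deriv \<psi> x)"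
    if "test_function a b \<phi>" "test_function a b \<psi>" for \<phi> \<psi> k
    using that by (auto intro!: DERIV_imp_deriv derivative_eq_intros test_function_DERIV)
  have "\<exists>C. \<forall>\<phi>. test_function a b \<phi> \<longrightarrow>
      L2_inner a b w (deriv \<phi>) = C * (LINT x|lebesgue_on {a..b}. \<phi> x)"
    by (rule functional_vanishing_on_derivatives[OF \<open>a < b\<close>])
      (simp_all add: deriv_lincomb L2_inner_lincomb_right w orth test_function_L2 test_function_deriv)
  then obtain C where C: "\<And>\<phi>. test_function a b \<phi> \<Longrightarrow>
      L2_inner a b w (deriv \<phi>) = C * (LINT x|lebesgue_on {a..b}. \<phi> x)"
    by blast
  have id: "L2 a b (\<lambda>x. x)"
    by (simp add: continuous_imp_L2)
  have "L2_inner a b (\<lambda>x. w x + C * x) (deriv \<phi>) = 0" if \<phi>: "test_function a b \<phi>" for \<phi>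
  proof -
    have "L2_inner a b (\<lambda>x. x) (deriv \<phi>) = - (LINT x|lebesgue_on {a..b}. 1 * \<phi> x)"
      unfolding L2_inner_def
      by (subst LINT_by_parts[where f="\<lambda>_. 1" and G=\<phi>])
        (use \<open>a < b\<close> test_function_DERIV[OF \<phi>] test_function_boundary[OF \<phi>]
          test_function_continuous[OF test_function_deriv[OF \<phi>]] in auto)
    then show ?thesis
      using L2_inner_lincomb_left[OF test_function_L2[OF test_function_deriv[OF \<phi>]] w id] C[OF \<phi>]
      by simp
  qed
  then obtain K where K: "AE x in lebesgue_on {a..b}. w x + C * x = K"
    using du_Bois_Reymond[OF \<open>a < b\<close> L2_lincomb[OF w id]] by blast
  have "AE x in lebesgue_on {a..b}. w x = K + (- C) * x"
    using K by eventually_elim simp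
  then show ?thesis by blast
qed

section \<open>The Dirichlet problem\<close>

lemma test_function_funpow_deriv: "test_function a b \<phi> \<Longrightarrow> test_function a b ((deriv ^^ n) \<phi>)"
  by (induction n) (auto intro: test_function_deriv)

lemma weak_deriv_0: "L2 a b f \<Longrightarrow> weak_deriv a b 0 f f"
  by (simp add: weak_deriv_def)

text \<open>One integration by parts moves a derivative from the test function to \<open>F\<close>,
  with no boundary terms. Iterating this gives a classical solution its weak derivatives.\<close>

lemma weak_deriv_Suc:
  assumes "a \<le> b" and f: "continuous_on {a..b} f"
    and F: "\<And>x. x \<in> {a..b} \<Longrightarrow> (F has_real_derivative f x) (at x within {a..b})"
    and D: "weak_deriv a b n f D"
  shows "weak_deriv a b (Suc n) F D"
  unfolding weak_deriv_def
proof (intro conjI allI impI)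
  show "L2 a b F"
    by (intro continuous_imp_L2 DERIV_continuous_on[OF F])
  show "L2 a b D"
    using D by (simp add: weak_deriv_def)
  fix \<phi> assume \<phi>: "test_function a b \<phi>"
  let ?\<eta> = "(deriv ^^ n) \<phi>"
  have \<eta>: "test_function a b ?\<eta>"
    using \<phi> by (rule test_function_funpow_deriv)
  have "L2_inner a b F (deriv ?\<eta>) = F b * ?\<eta> b - F a * ?\<eta> a - L2_inner a b f ?\<eta>"
    unfolding L2_inner_def
    by (rule LINT_by_parts[OF \<open>a \<le> b\<close> f test_function_continuous[OF test_function_deriv[OF \<eta>]] F])
      (auto intro: test_function_DERIV[OF \<eta>])
  then show "L2_inner a b F ((deriv ^^ Suc n) \<phi>) = (- 1) ^ Suc n * L2_inner a b D \<phi>"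
    using test_function_boundary[OF \<eta>] D \<phi> by (simp add: weak_deriv_def)
qed

lemma weak_deriv_lincomb:
  assumes "weak_deriv a b n f D" "weak_deriv a b n g E"
  shows "weak_deriv a b n (\<lambda>x. f x + c * g x) (\<lambda>x. D x + c * E x)"
  using assms test_function_funpow_deriv[of a b]
  by (simp add: weak_deriv_def L2_lincomb L2_inner_lincomb_left test_function_L2 algebra_simps)

lemma weak_deriv_unique:
  assumes "weak_deriv a b n f D" "weak_deriv a b n f E"
  shows "AE x in lebesgue_on {a..b}. D x = E x"
proof -
  have L2: "L2 a b D" "L2 a b E"
    using assms by (auto simp: weak_deriv_def)
  have "L2_inner a b (\<lambda>x. D x - E x) \<phi> = 0" if "test_function a b \<phi>" for \<phi>
  proof -
    have "(- 1) ^ n * L2_inner a b D \<phi> = (- 1) ^ n * L2_inner a b E \<phi>"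
      using assms that by (simp add: weak_deriv_def)
    then show ?thesis
      by (simp add: L2_inner_diff_left L2 test_function_L2 that)
  qed
  then have "AE x in lebesgue_on {a..b}. D x - E x = 0"
    by (intro fundamental_lemma L2_imp_integrable L2_diff L2)
  then show ?thesis by simp
qed

text \<open>The difference has second weak derivative 0, so it is affine almost everywhere, and
  everywhere by continuity, which \<open>0 < q\<close> supplies. An affine function that is 0 at
  both endpoints is 0.\<close>

lemma dirichlet_unique:
  assumes "a < b" "0 < q" "sobolev0 q a b y" "sobolev0 q a b z"
    and yz: "weak_deriv a b 2 y F" "weak_deriv a b 2 z F"
    and x: "x \<in> {a..b}"
  shows "y x = z x"
proof -
  have L2: "L2 a b y" "L2 a b z"
    using yz by (auto simp: weak_deriv_def)
  have "L2_inner a b (\<lambda>x. y x - z x) (deriv (deriv \<phi>)) = 0" if "test_function a b \<phi>" for \<phi>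
    using yz that L2_inner_diff_left[OF L2 test_function_L2[OF test_function_funpow_deriv[OF that, of 2]]]
    by (simp add: weak_deriv_def numeral_2_eq_2)
  then obtain C K where CK: "AE x in lebesgue_on {a..b}. y x - z x = K + C * x"
    using du_Bois_Reymond_2[OF \<open>a < b\<close> L2_diff[OF L2]] by blast
  have "continuous_on {a..b} (\<lambda>x. y x - z x)" "continuous_on {a..b} (\<lambda>x. K + C * x)"
    using assms by (auto simp: sobolev0_def sobolev_def intro!: continuous_intros)
  then have eq: "y x - z x = K + C * x" if "x \<in> {a..b}" for x
    using AE_eq_continuous_imp_eq[OF \<open>a < b\<close> _ _ CK that] by simp
  have "K + C * a = 0" "K + C * b = 0"
    using eq[of a] eq[of b] assms by (auto simp: sobolev0_def)
  then have "C * (b - a) = 0"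
    unfolding right_diff_distrib by linarith
  then have "C = 0"
    using \<open>a < b\<close> by simp
  then show ?thesis
    using eq[OF x] \<open>K + C * a = 0\<close> by simp
qed

text \<open>\<open>v\<close> is carried along as the continuous representative of the weak
  derivative, which \<open>wderiv\<close> fixes only up to a null set. The value 0 outside the
  interval is the normalization of \<open>dirichlet_sol\<close>, so that solutions can be equated as
  functions.\<close>

definition classical_sol ::
    "real \<Rightarrow> real \<Rightarrow> (real \<Rightarrow> real) \<Rightarrow> (real \<Rightarrow> real) \<Rightarrow> (real \<Rightarrow> real) \<Rightarrow> bool" where
  "classical_sol a b f y v \<longleftrightarrow>
     continuous_on {a..b} f \<and>
     (\<forall>x\<in>{a..b}. (y has_real_derivative v x) (at x within {a..b})) \<and>
     (\<forall>x\<in>{a..b}. (v has_real_derivative - f x) (at x within {a..b})) \<and>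
     y a = 0 \<and> y b = 0 \<and> (\<forall>x. x \<notin> {a..b} \<longrightarrow> y x = 0)"

lemma classical_sol_continuous:
  assumes "classical_sol a b f y v"
  shows "continuous_on {a..b} f" "continuous_on {a..b} y" "continuous_on {a..b} v"
  using assms unfolding classical_sol_def by (auto intro!: DERIV_continuous_on)

lemma classical_sol_exists:
  assumes "a < b" and f: "continuous_on {a..b} f"
  obtains y v where "classical_sol a b f y v"
proof -
  define F where "F x = integral {a..x} f" for x
  define FF where "FF x = integral {a..x} F" for x
  \<comment> \<open>Minus the double primitive \<open>FF\<close> solves the equation; the linear
    term is 0 at \<open>a\<close> and cancels \<open>FF\<close> at \<open>b\<close>.\<close>
  define y where "y x = (if x \<in> {a..b} then (x - a) / (b - a) * FF b - FF x else 0)" for x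
  define v where "v x = FF b / (b - a) - F x" for x
  have F: "(F has_real_derivative f x) (at x within {a..b})" if "x \<in> {a..b}" for x
    unfolding F_def[abs_def] using f that by (rule integral_has_real_derivative)
  then have "continuous_on {a..b} F"
    by (rule DERIV_continuous_on)
  then have FF: "(FF has_real_derivative F x) (at x within {a..b})" if "x \<in> {a..b}" for x
    unfolding FF_def[abs_def] using that by (rule integral_has_real_derivative)
  have "(y has_real_derivative v x) (at x within {a..b})" if x: "x \<in> {a..b}" for x
  proof (rule has_field_derivative_transform_within[where d=1])
    show "((\<lambda>x. (x - a) / (b - a) * FF b - FF x) has_real_derivative v x) (at x within {a..b})"
      unfolding v_def using FF[OF x] \<open>a < b\<close> by (auto intro!: derivative_eq_intros)
  qed (use x in \<open>auto simp: y_def\<close>)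
  moreover have "(v has_real_derivative - f x) (at x within {a..b})" if "x \<in> {a..b}" for x
    unfolding v_def[abs_def] using F[OF that] by (auto intro!: derivative_eq_intros)
  moreover have "y a = 0" "y b = 0" "\<And>x. x \<notin> {a..b} \<Longrightarrow> y x = 0"
    using \<open>a < b\<close> by (auto simp: y_def FF_def)
  ultimately have "classical_sol a b f y v"
    using f by (simp add: classical_sol_def)
  then show ?thesis by (rule that)
qed

lemma classical_sol_weak_deriv:
  assumes "a < b" and y: "classical_sol a b f y v"
  shows "weak_deriv a b 1 y v" "weak_deriv a b 2 y (\<lambda>x. - f x)"
    and "weak_deriv a b 1 f D \<Longrightarrow> weak_deriv a b 3 y (\<lambda>x. - D x)"
proof -
  note cont = classical_sol_continuous[OF y]
  have y': "(y has_real_derivative v x) (at x within {a..b})"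
    and v': "(v has_real_derivative - f x) (at x within {a..b})" if "x \<in> {a..b}" for x
    using y that by (auto simp: classical_sol_def)
  have cont_f: "continuous_on {a..b} (\<lambda>x. - f x)"
    by (intro continuous_intros cont)
  have "a \<le> b"
    using \<open>a < b\<close> by simp
  show "weak_deriv a b 1 y v"
    using weak_deriv_Suc[OF \<open>a \<le> b\<close> cont(3) y' weak_deriv_0[OF continuous_imp_L2[OF cont(3)]]]
    by simp
  \<comment> \<open>Two applications turn an \<open>n\<close>-th weak derivative of
    \<open>- f\<close> into one of order \<open>n + 2\<close> for \<open>y\<close>; it is used with
    \<open>n = 0\<close> and \<open>n = 1\<close>.\<close>
  note step = weak_deriv_Suc[OF \<open>a \<le> b\<close> cont(3) y' weak_deriv_Suc[OF \<open>a \<le> b\<close> cont_f v']]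
  show "weak_deriv a b 2 y (\<lambda>x. - f x)"
    using step[OF _ _ weak_deriv_0[OF continuous_imp_L2[OF cont_f]]] by (simp add: numeral_2_eq_2)
  assume D: "weak_deriv a b 1 f D"
  have "weak_deriv a b 1 (\<lambda>x. - f x) (\<lambda>x. - D x)"
    \<comment> \<open>Negation is obtained as \<open>f x + (-2) * f x\<close>.\<close>
    using weak_deriv_lincomb[OF D D, of "-2"] by simp
  then show "weak_deriv a b 3 y (\<lambda>x. - D x)"
    using step[of 1 "\<lambda>x. - D x"] by (simp add: numeral_3_eq_3)
qed

text \<open>The classical solution lies in the required Sobolev space and is the only candidate for
  the definite description. For order 3, membership comes from a weak derivative of the right-hand
  side.\<close>

lemma dirichlet_sol_eq:
  assumes "a < b" and y: "classical_sol a b f y v"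
    and q: "q = 2 \<or> q = 3 \<and> weak_deriv a b 1 f D"
  shows "dirichlet_sol q a b f = y"
  unfolding dirichlet_sol_def
proof (rule the_equality)
  have weak: "\<exists>D. weak_deriv a b n y D" if "n \<le> q" for n
  proof -
    consider "n = 0" | "n = 1" | "n = 2" | "n = 3" "q = 3"
      using \<open>n \<le> q\<close> q by linarith
    then show ?thesis
      using classical_sol_weak_deriv[OF assms(1,2)] q
        weak_deriv_0[OF continuous_imp_L2[OF classical_sol_continuous(2)[OF y]]]
      by cases auto
  qed
  then have "sobolev0 q a b y"
    using y classical_sol_continuous(2)[OF y] by (simp add: sobolev0_def sobolev_def classical_sol_def)
  then show y_sol: "sobolev0 q a b y \<and> weak_deriv a b 2 y (\<lambda>x. - f x) \<and> (\<forall>x. x \<notin> {a..b} \<longrightarrow> y x = 0)"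
    using y classical_sol_weak_deriv(2)[OF assms(1,2)] by (simp add: classical_sol_def)
  fix z
  assume "sobolev0 q a b z \<and> weak_deriv a b 2 z (\<lambda>x. - f x) \<and> (\<forall>x. x \<notin> {a..b} \<longrightarrow> z x = 0)"
  then show "z = y"
    using y_sol q dirichlet_unique[OF \<open>a < b\<close>, of q z y] by (metis ext zero_less_numeral)
qed

text \<open>\<open>v\<close> witnesses that the choice in \<open>wderiv\<close> succeeds; uniqueness
  of weak derivatives then identifies the chosen representative with \<open>v\<close> almost
  everywhere.\<close>

lemma classical_sol_wderiv:
  assumes "a < b" "classical_sol a b f y v"
  shows "AE x in lebesgue_on {a..b}. wderiv a b y x = v x"
    and "wderiv a b y \<in> borel_measurable (lebesgue_on {a..b})"
proof -
  have v: "weak_deriv a b 1 y v"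
    using classical_sol_weak_deriv(1)[OF assms] .
  then have w: "weak_deriv a b 1 y (wderiv a b y)"
    unfolding wderiv_def by (rule someI[where P="weak_deriv a b 1 y"])
  show "AE x in lebesgue_on {a..b}. wderiv a b y x = v x"
    using w v by (rule weak_deriv_unique)
  show "wderiv a b y \<in> borel_measurable (lebesgue_on {a..b})"
    using w by (simp add: weak_deriv_def L2_def)
qed

lemma classical_sol_lincomb:
  assumes "classical_sol a b f y v" "classical_sol a b g z w"
    and "\<And>x. x \<in> {a..b} \<Longrightarrow> h x = f x + c * g x"
  shows "classical_sol a b h (\<lambda>x. y x + c * z x) (\<lambda>x. v x + c * w x)"
proof -
  have "continuous_on {a..b} h \<longleftrightarrow> continuous_on {a..b} (\<lambda>x. f x + c * g x)"
    by (rule continuous_on_cong) (use assms(3) in auto)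
  then show ?thesis
    using assms(1,2) unfolding classical_sol_def
    by (auto simp: assms(3) intro!: continuous_intros derivative_eq_intros)
qed

text \<open>Integrate \<open>v x * w x\<close> by parts: \<open>v\<close> has derivative
  \<open>- f\<close>, and \<open>z\<close> vanishes at both endpoints. The right-hand side is
  symmetric in the two solutions.\<close>

lemma classical_sol_green:
  assumes "a < b" "classical_sol a b f y v" "classical_sol a b g z w"
  shows "(LINT x|lebesgue_on {a..b}. f x * z x) = (LINT x|lebesgue_on {a..b}. v x * w x)"
proof -
  have "(LINT x|lebesgue_on {a..b}. v x * w x)
      = v b * z b - v a * z a - (LINT x|lebesgue_on {a..b}. - f x * z x)"
    by (rule LINT_by_parts)
      (use assms classical_sol_continuous[OF assms(2)] classical_sol_continuous[OF assms(3)]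
       in \<open>auto simp: classical_sol_def intro!: continuous_intros\<close>)
  then show ?thesis
    using assms(3) by (simp add: classical_sol_def)
qed

section \<open>The integration operator and its adjoint\<close>

lemma T_D_eq:
  assumes "x \<in> {a..b}"
  shows "T_D a f x = (LINT \<xi>|lebesgue_on {a..b}. (if \<xi> \<in> {a..x} then f \<xi> else 0))"
  unfolding T_D_def using assms by (subst integral_restrict) auto

lemma T_D_continuous: "L2 a b f \<Longrightarrow> continuous_on {a..b} (T_D a f)"
  unfolding T_D_def[abs_def]
  by (intro indefinite_integral_continuous_real L2_imp_integrable)

lemma T_D_lincomb:
  assumes "L2 a b f" "L2 a b g" "x \<in> {a..b}"
  shows "T_D a (\<lambda>y. f y + c * g y) x = T_D a f x + c * T_D a g x"
proof -
  have "integrable (lebesgue_on {a..x}) f" "integrable (lebesgue_on {a..x}) g"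
    using assms(3) by (auto intro!: integrable_subinterval[OF L2_imp_integrable] assms(1,2))
  then show ?thesis by (simp add: T_D_def)
qed

text \<open>Splitting the integral at \<open>x\<close> writes the adjoint as a constant minus
  \<open>T_D\<close>, from which it inherits continuity and square integrability.\<close>

lemma T_D_adjoint_eq:
  assumes "L2 a b f" "x \<in> {a..b}"
  shows "(LINT \<xi>|lebesgue_on {x..b}. f \<xi>) = (LINT \<xi>|lebesgue_on {a..b}. f \<xi>) - T_D a f x"
proof -
  note f = L2_imp_integrable[OF assms(1)]
  have "integrable (lebesgue_on {a..x}) f" "integrable (lebesgue_on {x..b}) f"
    using assms(2) by (auto intro!: integrable_subinterval[OF f])
  then have "(LINT \<xi>|lebesgue_on {x..b}. f \<xi>) = integral {x..b} f" "T_D a f x = integral {a..x} f"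
    by (simp_all add: T_D_def lebesgue_integral_eq_integral)
  moreover have "(LINT \<xi>|lebesgue_on {a..b}. f \<xi>) = integral {a..b} f"
    using f by (simp add: lebesgue_integral_eq_integral)
  moreover have "integral {a..x} f + integral {x..b} f = integral {a..b} f"
    by (rule Henstock_Kurzweil_Integration.integral_combine)
      (use assms(2) f in \<open>auto intro: integrable_on_lebesgue_on\<close>)
  ultimately show ?thesis by simp
qed

lemma T_D_L2: "L2 a b f \<Longrightarrow> L2 a b (T_D a f)"
  by (simp add: continuous_imp_L2 T_D_continuous)

lemma T_D_adjoint_L2: "L2 a b f \<Longrightarrow> L2 a b (\<lambda>x. LINT \<xi>|lebesgue_on {x..b}. f \<xi>)"
  by (subst L2_cong[OF T_D_adjoint_eq]) (auto intro!: continuous_imp_L2 continuous_intros T_D_continuous)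

text \<open>Both sides are iterated integrals of \<open>f \<xi> * h x\<close> over the triangle
  \<open>\<xi> \<le> x\<close>, in opposite orders; Fubini exchanges them.\<close>

lemma T_D_adjoint:
  assumes f: "L2 a b f" and h: "L2 a b h"
  shows "L2_inner a b (T_D a f) h = L2_inner a b f (\<lambda>x. LINT \<xi>|lebesgue_on {x..b}. h \<xi>)"
proof -
  let ?M = "lebesgue_on {a..b}"
  define k where "k \<xi> x = (if \<xi> \<le> x then f \<xi> * h x else 0)" for \<xi> x
  interpret finite_measure ?M
    by (rule finite_measure_lebesgue_on) simp
  interpret pair_sigma_finite ?M ?M ..
  note f_int = L2_imp_integrable[OF f] and h_int = L2_imp_integrable[OF h]
  have [measurable]: "f \<in> borel_measurable ?M" "h \<in> borel_measurable ?M" "(\<lambda>x. x) \<in> borel_measurable ?M"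
    using f h id_borel_measurable_lebesgue_on by (auto simp: L2_def id_def)
  have meas: "case_prod k \<in> borel_measurable (?M \<Otimes>\<^sub>M ?M)"
    unfolding k_def by measurable
  have int: "integrable (?M \<Otimes>\<^sub>M ?M) (case_prod k)"
  proof (rule Bochner_Integration.integrable_bound[OF _ meas])
    \<comment> \<open>The kernel is dominated by the full product, which is integrable on the square
      because each factor is integrable.\<close>
    show "integrable (?M \<Otimes>\<^sub>M ?M) (\<lambda>(\<xi>, x). f \<xi> * h x)"
    proof (rule Fubini_integrable)
      show "integrable ?M (\<lambda>\<xi>. LINT x|?M. norm (case (\<xi>, x) of (\<xi>, x) \<Rightarrow> f \<xi> * h x))"
        using f_int by (simp add: abs_mult)
      show "AE \<xi> in ?M. integrable ?M (\<lambda>x. case (\<xi>, x) of (\<xi>, x) \<Rightarrow> f \<xi> * h x)"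
        using h_int by simp
    qed measurable
    show "AE p in ?M \<Otimes>\<^sub>M ?M. norm (case_prod k p) \<le> norm (case p of (\<xi>, x) \<Rightarrow> f \<xi> * h x)"
      by (intro AE_I2) (auto simp: k_def)
  qed
  have "L2_inner a b (T_D a f) h = (LINT x|?M. LINT \<xi>|?M. k \<xi> x)"
    unfolding L2_inner_def
  proof (rule Bochner_Integration.integral_cong[OF refl])
    fix x assume "x \<in> space ?M"
    then have x: "x \<in> {a..b}" by simp
    have "(LINT \<xi>|?M. k \<xi> x) = (LINT \<xi>|?M. (if \<xi> \<in> {a..x} then f \<xi> else 0) * h x)"
      by (intro Bochner_Integration.integral_cong) (auto simp: k_def)
    then show "T_D a f x * h x = (LINT \<xi>|?M. k \<xi> x)"
      by (simp add: T_D_eq[OF x])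
  qed
  also have "\<dots> = (LINT \<xi>|?M. LINT x|?M. k \<xi> x)"
    by (rule Fubini_integral[OF int])
  also have "\<dots> = L2_inner a b f (\<lambda>x. LINT \<xi>|lebesgue_on {x..b}. h \<xi>)"
    unfolding L2_inner_def
  proof (rule Bochner_Integration.integral_cong[OF refl])
    fix \<xi> assume "\<xi> \<in> space ?M"
    then have \<xi>: "\<xi> \<in> {a..b}" by simp
    have "(LINT x|?M. k \<xi> x) = (LINT x|?M. f \<xi> * (if x \<in> {\<xi>..b} then h x else 0))"
      by (intro Bochner_Integration.integral_cong) (auto simp: k_def)
    also have "\<dots> = f \<xi> * (LINT x|?M. (if x \<in> {\<xi>..b} then h x else 0))"
      by simp
    also have "(LINT x|?M. (if x \<in> {\<xi>..b} then h x else 0)) = (LINT x|lebesgue_on {\<xi>..b}. h x)"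
      using \<xi> by (intro integral_restrict) auto
    finally show "(LINT x|?M. k \<xi> x) = f \<xi> * (LINT x|lebesgue_on {\<xi>..b}. h x)" .
  qed
  finally show ?thesis .
qed

text \<open>The adjoint maps \<open>deriv \<phi>\<close> to \<open>- \<phi>\<close>, so up to sign
  the pairing of \<open>h\<close> with \<open>\<phi>\<close> is that of \<open>T_D a h\<close> with
  \<open>deriv \<phi>\<close>, which is 0. The fundamental lemma concludes.\<close>

lemma T_D_eq_0D:
  assumes "a < b" "L2 a b h" "\<And>x. x \<in> {a..b} \<Longrightarrow> T_D a h x = 0"
  shows "L2_eq a b h (\<lambda>x. 0)"
  unfolding L2_eq_def
proof (rule fundamental_lemma)
  show "integrable (lebesgue_on {a..b}) h"
    using assms by (simp add: L2_imp_integrable)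
  fix \<phi> assume \<phi>: "test_function a b \<phi>"
  have "(LINT \<xi>|lebesgue_on {x..b}. deriv \<phi> \<xi>) = - \<phi> x" if "x \<in> {a..b}" for x
    using that LINT_FTC[of x b "deriv \<phi>" \<phi>] test_function_boundary(2)[OF \<phi>]
      test_function_continuous[OF test_function_deriv[OF \<phi>]] test_function_DERIV[OF \<phi>] by simp
  then have "- L2_inner a b h \<phi> = L2_inner a b h (\<lambda>x. LINT \<xi>|lebesgue_on {x..b}. deriv \<phi> \<xi>)"
    unfolding L2_inner_def Bochner_Integration.integral_minus[symmetric]
    by (intro Bochner_Integration.integral_cong) auto
  also have "\<dots> = L2_inner a b (T_D a h) (deriv \<phi>)"
    using T_D_adjoint[OF assms(2) test_function_L2[OF test_function_deriv[OF \<phi>]]] by simp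
  also have "\<dots> = (LINT x|lebesgue_on {a..b}. 0)"
    unfolding L2_inner_def by (intro Bochner_Integration.integral_cong) (auto simp: assms(3))
  finally show "L2_inner a b h \<phi> = 0" by simp
qed

section \<open>The functional and its derivatives\<close>

lemma u_sol_classical:
  assumes "a < b" "L2 a b \<psi>"
  obtains v where "classical_sol a b (T_D a \<psi>) (u_sol a b \<psi>) v"
proof -
  obtain y v where y: "classical_sol a b (T_D a \<psi>) y v"
    using classical_sol_exists[OF assms(1) T_D_continuous[OF assms(2)]] .
  then show ?thesis
    using dirichlet_sol_eq[OF assms(1) y, of 2] that by (simp add: u_sol_def)
qed

lemma u_data_classical:
  assumes "a < b" "sobolev 1 a b g"
  obtains v where "classical_sol a b (\<lambda>x. g x - g a) (u_data a b g) v"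
proof -
  obtain D where g: "continuous_on {a..b} g" and D: "weak_deriv a b 1 g D"
    using assms(2) by (auto simp: sobolev_def)
  obtain y v where y: "classical_sol a b (\<lambda>x. g x - g a) y v"
    by (rule classical_sol_exists[OF assms(1), of "\<lambda>x. g x - g a"]) (auto intro!: continuous_intros g)
  \<comment> \<open>Subtracting the constant \<open>g a\<close> keeps the weak derivative
    \<open>D\<close>, which the order 3 case of \<open>dirichlet_sol_eq\<close> asks for.\<close>
  have "weak_deriv a b 1 (\<lambda>_. g a) (\<lambda>_. 0)"
    using weak_deriv_Suc[of a b "\<lambda>_. 0" "\<lambda>_. g a" 0 "\<lambda>_. 0"] assms(1)
    by (simp add: weak_deriv_0 continuous_imp_L2)
  then have "weak_deriv a b 1 (\<lambda>x. g x - g a) D"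
    using weak_deriv_lincomb[OF D, of "\<lambda>_. g a" "\<lambda>_. 0" "-1"] by simp
  then show ?thesis
    using dirichlet_sol_eq[OF assms(1) y, of 3] y that by (simp add: u_data_def)
qed

text \<open>Superposition of classical solutions together with uniqueness. The equation holds
  between functions because all solutions are 0 outside the interval.\<close>

lemma u_sol_lincomb:
  assumes "a < b" "L2 a b \<psi>" "L2 a b h"
  shows "u_sol a b (\<lambda>x. \<psi> x + c * h x) = (\<lambda>x. u_sol a b \<psi> x + c * u_sol a b h x)"
proof -
  obtain v w where "classical_sol a b (T_D a \<psi>) (u_sol a b \<psi>) v"
    and "classical_sol a b (T_D a h) (u_sol a b h) w"
    using u_sol_classical assms by metis
  then have "classical_sol a b (T_D a (\<lambda>x. \<psi> x + c * h x))
      (\<lambda>x. u_sol a b \<psi> x + c * u_sol a b h x) (\<lambda>x. v x + c * w x)"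
    by (rule classical_sol_lincomb) (rule T_D_lincomb[OF assms(2,3)])
  then show ?thesis
    unfolding u_sol_def[of a b "\<lambda>x. \<psi> x + c * h x"] using dirichlet_sol_eq[OF assms(1)] by blast
qed

text \<open>Replacing weak derivatives by \<open>v\<close> and \<open>v0\<close> almost everywhere
  leaves three integrals of continuous functions, to which Green's identity applies.\<close>

lemma G_fun_classical:
  assumes "a < b"
    and u: "classical_sol a b f0 (u_data a b g) v0"
    and u\<psi>: "classical_sol a b f (u_sol a b \<psi>) v"
  shows "G_fun a b g \<psi> = (LINT x|lebesgue_on {a..b}. v x * v x)
    - 2 * (LINT x|lebesgue_on {a..b}. v x * v0 x) + (LINT x|lebesgue_on {a..b}. v0 x * v0 x)"
proof -
  let ?M = "lebesgue_on {a..b}"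
  note wu = classical_sol_wderiv[OF \<open>a < b\<close> u] and w\<psi> = classical_sol_wderiv[OF \<open>a < b\<close> u\<psi>]
  note cont = classical_sol_continuous(3)[OF u] classical_sol_continuous(3)[OF u\<psi>]
  have int: "integrable ?M (\<lambda>x. v x * v x)" "integrable ?M (\<lambda>x. v x * v0 x)"
    "integrable ?M (\<lambda>x. v0 x * v0 x)"
    by (intro continuous_imp_integrable_real continuous_intros cont)+
  have [measurable]: "v \<in> borel_measurable ?M" "v0 \<in> borel_measurable ?M"
    by (intro borel_measurable_integrable continuous_imp_integrable_real cont)+
  have [measurable]: "wderiv a b (u_data a b g) \<in> borel_measurable ?M"
    "wderiv a b (u_sol a b \<psi>) \<in> borel_measurable ?M"
    using wu w\<psi> by auto
  let ?d = "\<lambda>x. wderiv a b (u_sol a b \<psi>) x - wderiv a b (u_data a b g) x"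
  have "G_fun a b g \<psi> = (LINT x|?M. ?d x * ?d x)"
    unfolding G_fun_def L2_norm_def L2_inner_def by (intro real_sqrt_pow2 integral_nonneg_AE) simp
  also have "\<dots> = (LINT x|?M. v x * v x - 2 * (v x * v0 x) + v0 x * v0 x)"
  proof (rule Bochner_Integration.integral_cong_AE)
    show "AE x in ?M. ?d x * ?d x = v x * v x - 2 * (v x * v0 x) + v0 x * v0 x"
      using wu(1) w\<psi>(1) by eventually_elim (simp add: algebra_simps)
  qed measurable
  also have "\<dots> = (LINT x|?M. v x * v x) - 2 * (LINT x|?M. v x * v0 x) + (LINT x|?M. v0 x * v0 x)"
    using int by simp
  finally show ?thesis .
qed

lemma G_fun_eq_energy:
  assumes "a < b" "sobolev 1 a b g" "L2 a b \<psi>"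
  shows "G_fun a b g \<psi> = (LINT x|lebesgue_on {a..b}.
    ((wderiv a b (u_data a b g) x)\<^sup>2 - (wderiv a b (u_sol a b \<psi>) x)\<^sup>2)
    - 2 * T_D a \<psi> x * (u_data a b g x - u_sol a b \<psi> x))"
proof -
  let ?M = "lebesgue_on {a..b}"
  let ?u = "u_data a b g" and ?v = "u_sol a b \<psi>"
  obtain v0 where u: "classical_sol a b (\<lambda>x. g x - g a) ?u v0"
    using u_data_classical[OF assms(1,2)] .
  obtain v where u\<psi>: "classical_sol a b (T_D a \<psi>) ?v v"
    using u_sol_classical[OF assms(1,3)] .
  note wu = classical_sol_wderiv[OF \<open>a < b\<close> u] and w\<psi> = classical_sol_wderiv[OF \<open>a < b\<close> u\<psi>]
  note cont = classical_sol_continuous[OF u] classical_sol_continuous[OF u\<psi>]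
  have int: "integrable ?M (\<lambda>x. v x * v x)" "integrable ?M (\<lambda>x. v0 x * v0 x)"
    "integrable ?M (\<lambda>x. T_D a \<psi> x * ?u x)" "integrable ?M (\<lambda>x. T_D a \<psi> x * ?v x)"
    by (intro continuous_imp_integrable_real continuous_intros cont)+
  have [measurable]: "v \<in> borel_measurable ?M" "v0 \<in> borel_measurable ?M"
    "?u \<in> borel_measurable ?M" "?v \<in> borel_measurable ?M" "T_D a \<psi> \<in> borel_measurable ?M"
    by (intro borel_measurable_integrable continuous_imp_integrable_real cont)+
  have [measurable]: "wderiv a b ?u \<in> borel_measurable ?M" "wderiv a b ?v \<in> borel_measurable ?M"
    using wu w\<psi> by auto
  have "(LINT x|?M. ((wderiv a b ?u x)\<^sup>2 - (wderiv a b ?v x)\<^sup>2) - 2 * T_D a \<psi> x * (?u x - ?v x))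
      = (LINT x|?M. (v0 x * v0 x - v x * v x) - 2 * (T_D a \<psi> x * ?u x) + 2 * (T_D a \<psi> x * ?v x))"
  proof (rule Bochner_Integration.integral_cong_AE)
    show "AE x in ?M. ((wderiv a b ?u x)\<^sup>2 - (wderiv a b ?v x)\<^sup>2) - 2 * T_D a \<psi> x * (?u x - ?v x)
        = (v0 x * v0 x - v x * v x) - 2 * (T_D a \<psi> x * ?u x) + 2 * (T_D a \<psi> x * ?v x)"
      using wu(1) w\<psi>(1) by eventually_elim (simp add: algebra_simps power2_eq_square)
  qed measurable
  also have "\<dots> = (LINT x|?M. v0 x * v0 x) - (LINT x|?M. v x * v x)
      - 2 * (LINT x|?M. T_D a \<psi> x * ?u x) + 2 * (LINT x|?M. T_D a \<psi> x * ?v x)"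
    using int by simp
  \<comment> \<open>By Green, \<open>T_D a \<psi>\<close> paired with \<open>u_data\<close> is the
    mixed energy, and paired with \<open>u_sol\<close> it is the energy of \<open>v\<close>; twice
    the latter flips the sign of the \<open>v\<close> term.\<close>
  also have "\<dots> = (LINT x|?M. v0 x * v0 x) + (LINT x|?M. v x * v x) - 2 * (LINT x|?M. v x * v0 x)"
    using classical_sol_green[OF \<open>a < b\<close> u\<psi> u] classical_sol_green[OF \<open>a < b\<close> u\<psi> u\<psi>] by simp
  finally show ?thesis
    using G_fun_classical[OF \<open>a < b\<close> u u\<psi>] by simp
qed

lemma G_fun_diff:
  assumes "a < b" "sobolev 1 a b g" "L2 a b \<psi>1" "L2 a b \<psi>2"
  shows "G_fun a b g \<psi>1 - G_fun a b g \<psi>2 = (LINT x|lebesgue_on {a..b}.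
    - 2 * T_D a (\<lambda>y. \<psi>1 y - \<psi>2 y) x * (u_data a b g x - (u_sol a b \<psi>1 x + u_sol a b \<psi>2 x) / 2))"
proof -
  let ?M = "lebesgue_on {a..b}"
  let ?u = "u_data a b g" and ?f1 = "T_D a \<psi>1" and ?u1 = "u_sol a b \<psi>1"
    and ?f2 = "T_D a \<psi>2" and ?u2 = "u_sol a b \<psi>2"
  obtain v0 where u: "classical_sol a b (\<lambda>x. g x - g a) ?u v0"
    using u_data_classical[OF assms(1,2)] .
  obtain v1 where u1: "classical_sol a b ?f1 ?u1 v1"
    using u_sol_classical[OF assms(1,3)] .
  obtain v2 where u2: "classical_sol a b ?f2 ?u2 v2"
    using u_sol_classical[OF assms(1,4)] .
  note cont = classical_sol_continuous[OF u] classical_sol_continuous[OF u1] classical_sol_continuous[OF u2]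
  note green = classical_sol_green[OF \<open>a < b\<close>]
  have int: "integrable ?M (\<lambda>x. ?f1 x * ?u x)" "integrable ?M (\<lambda>x. ?f1 x * ?u1 x)"
    "integrable ?M (\<lambda>x. ?f1 x * ?u2 x)" "integrable ?M (\<lambda>x. ?f2 x * ?u x)"
    "integrable ?M (\<lambda>x. ?f2 x * ?u1 x)" "integrable ?M (\<lambda>x. ?f2 x * ?u2 x)"
    by (intro continuous_imp_integrable_real continuous_intros cont)+
  have "(LINT x|?M. - 2 * T_D a (\<lambda>y. \<psi>1 y - \<psi>2 y) x * (?u x - (?u1 x + ?u2 x) / 2))
      = (LINT x|?M. (?f1 x * ?u1 x + ?f1 x * ?u2 x - 2 * (?f1 x * ?u x))
          - (?f2 x * ?u1 x + ?f2 x * ?u2 x - 2 * (?f2 x * ?u x)))"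
  proof (rule Bochner_Integration.integral_cong[OF refl])
    fix x assume "x \<in> space ?M"
    then have T_D_diff: "T_D a (\<lambda>y. \<psi>1 y - \<psi>2 y) x = ?f1 x - ?f2 x"
      using T_D_lincomb[OF assms(3,4), of x "-1"] by simp
    show "- 2 * T_D a (\<lambda>y. \<psi>1 y - \<psi>2 y) x * (?u x - (?u1 x + ?u2 x) / 2)
        = (?f1 x * ?u1 x + ?f1 x * ?u2 x - 2 * (?f1 x * ?u x))
          - (?f2 x * ?u1 x + ?f2 x * ?u2 x - 2 * (?f2 x * ?u x))"
      unfolding T_D_diff by (simp add: field_simps)
  qed
  also have "\<dots> = ((LINT x|?M. ?f1 x * ?u1 x) + (LINT x|?M. ?f1 x * ?u2 x) - 2 * (LINT x|?M. ?f1 x * ?u x))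
      - ((LINT x|?M. ?f2 x * ?u1 x) + (LINT x|?M. ?f2 x * ?u2 x) - 2 * (LINT x|?M. ?f2 x * ?u x))"
    using int by simp
  \<comment> \<open>The mixed terms \<open>?f1 x * ?u2 x\<close> and \<open>?f2 x * ?u1 x\<close>
    have equal integrals by the symmetry in Green's identity and cancel.\<close>
  also have "\<dots> = (LINT x|?M. v1 x * v1 x) - 2 * (LINT x|?M. v1 x * v0 x)
      - ((LINT x|?M. v2 x * v2 x) - 2 * (LINT x|?M. v2 x * v0 x))"
    using green[OF u1 u1] green[OF u1 u2] green[OF u1 u] green[OF u2 u1] green[OF u2 u2] green[OF u2 u]
    by (simp add: mult.commute)
  finally show ?thesis
    using G_fun_classical[OF \<open>a < b\<close> u u1] G_fun_classical[OF \<open>a < b\<close> u u2] by simp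
qed

lemma G_fun_gateaux:
  assumes "a < b" "sobolev 1 a b g" "L2 a b \<psi>" "L2 a b h"
  shows "has_gateaux_deriv (G_fun a b g) \<psi> h
    (LINT x|lebesgue_on {a..b}. T_D a h x * (- 2 * (u_data a b g x - u_sol a b \<psi> x)))"
proof -
  let ?M = "lebesgue_on {a..b}"
  let ?u = "u_data a b g" and ?v = "u_sol a b \<psi>" and ?w = "u_sol a b h"
  let ?D = "LINT x|?M. T_D a h x * (- 2 * (?u x - ?v x))" and ?c = "LINT x|?M. T_D a h x * ?w x"
  obtain v0 v w where sols: "classical_sol a b (\<lambda>x. g x - g a) ?u v0"
    "classical_sol a b (T_D a \<psi>) ?v v" "classical_sol a b (T_D a h) ?w w"
    using u_data_classical[OF assms(1,2)] u_sol_classical[OF assms(1,3)] u_sol_classical[OF assms(1,4)]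
    by metis
  have int: "integrable ?M (\<lambda>x. T_D a h x * (- 2 * (?u x - ?v x)))" "integrable ?M (\<lambda>x. T_D a h x * ?w x)"
    by (intro continuous_imp_integrable_real continuous_intros sols[THEN classical_sol_continuous(1)]
        sols[THEN classical_sol_continuous(2)])+
  \<comment> \<open>The difference formula at \<open>\<psi> + \<epsilon> h\<close> and
    \<open>\<psi>\<close>, with linearity of \<open>u_sol\<close>, makes the quotient affine in
    \<open>\<epsilon>\<close>; its constant term is the derivative.\<close>
  have quot: "(G_fun a b g (\<lambda>x. \<psi> x + \<epsilon> * h x) - G_fun a b g \<psi>) / \<epsilon> = ?D + \<epsilon> * ?c"
    if "\<epsilon> \<noteq> 0" for \<epsilon>
  proof -
    have "G_fun a b g (\<lambda>x. \<psi> x + \<epsilon> * h x) - G_fun a b g \<psi>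
        = (LINT x|?M. \<epsilon> * (T_D a h x * (- 2 * (?u x - ?v x)) + \<epsilon> * (T_D a h x * ?w x)))"
      unfolding G_fun_diff[OF assms(1,2) L2_lincomb[OF assms(3,4)] assms(3)] u_sol_lincomb[OF assms(1,3,4)]
      by (rule Bochner_Integration.integral_cong) (auto simp: T_D_def field_simps)
    also have "\<dots> = \<epsilon> * (?D + \<epsilon> * ?c)"
      using int by simp
    finally show ?thesis
      using that by simp
  qed
  have "((\<lambda>\<epsilon>. ?D + \<epsilon> * ?c) \<longlongrightarrow> ?D + 0 * ?c) (at 0)"
    by (intro tendsto_intros)
  moreover have "\<forall>\<^sub>F \<epsilon> in at 0. ?D + \<epsilon> * ?c
      = (G_fun a b g (\<lambda>x. \<psi> x + \<epsilon> * h x) - G_fun a b g \<psi>) / \<epsilon>"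
    using quot by (simp add: eventually_at_filter)
  ultimately show ?thesis
    unfolding has_gateaux_deriv_def using Lim_transform_eventually by force
qed

section \<open>Second derivative, positivity and gradient\<close>

lemma has_gateaux_deriv_imp_eq: "has_gateaux_deriv F \<psi> h D \<Longrightarrow> gateaux_deriv F \<psi> h = D"
  unfolding has_gateaux_deriv_def gateaux_deriv_def by (intro tendsto_Lim) auto

lemma has_gateaux_deriv_unique:
  "has_gateaux_deriv F \<psi> h D \<Longrightarrow> has_gateaux_deriv F \<psi> h E \<Longrightarrow> D = E"
  using has_gateaux_deriv_imp_eq by metis

text \<open>The first derivative depends on the base point only through \<open>u_sol\<close>, hence
  affinely, and its difference quotients are constant. The inverse Laplacian of
  \<open>T_D a h\<close> is \<open>u_sol a b h\<close> itself.\<close>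

lemma G_fun_gateaux2:
  assumes "a < b" "sobolev 1 a b g" "L2 a b \<psi>" "L2 a b h" "L2 a b k"
  shows "has_gateaux_deriv2 (G_fun a b g) \<psi> h k
    (2 * L2_inner a b (neg_inv_laplacian a b (T_D a h)) (T_D a k))"
proof -
  let ?M = "lebesgue_on {a..b}"
  let ?u = "u_data a b g" and ?v = "u_sol a b \<psi>" and ?w = "u_sol a b h"
  let ?D = "LINT x|?M. T_D a k x * (- 2 * (?u x - ?v x))" and ?E = "LINT x|?M. T_D a k x * ?w x"
  obtain v0 v w z where sols: "classical_sol a b (\<lambda>x. g x - g a) ?u v0"
    "classical_sol a b (T_D a \<psi>) ?v v" "classical_sol a b (T_D a h) ?w w"
    "classical_sol a b (T_D a k) (u_sol a b k) z"
    using u_data_classical[OF assms(1,2)] u_sol_classical[OF assms(1)] assms(3-5) by metis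
  have int: "integrable ?M (\<lambda>x. T_D a k x * (- 2 * (?u x - ?v x)))" "integrable ?M (\<lambda>x. T_D a k x * ?w x)"
    by (intro continuous_imp_integrable_real continuous_intros sols[THEN classical_sol_continuous(1)]
        sols[THEN classical_sol_continuous(2)])+
  have deriv: "gateaux_deriv (G_fun a b g) (\<lambda>x. \<psi> x + \<epsilon> * h x) k = ?D + \<epsilon> * (2 * ?E)" for \<epsilon>
  proof -
    have "gateaux_deriv (G_fun a b g) (\<lambda>x. \<psi> x + \<epsilon> * h x) k
        = (LINT x|?M. T_D a k x * (- 2 * (?u x - ?v x)) + (\<epsilon> * 2) * (T_D a k x * ?w x))"
      unfolding has_gateaux_deriv_imp_eq[OF G_fun_gateaux[OF assms(1,2) L2_lincomb[OF assms(3,4)] assms(5)]]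
        u_sol_lincomb[OF assms(1,3,4)]
      by (rule Bochner_Integration.integral_cong) (auto simp: algebra_simps)
    also have "\<dots> = ?D + (\<epsilon> * 2) * ?E"
      using int by simp
    finally show ?thesis by simp
  qed
  have "gateaux_deriv (G_fun a b g) \<psi> k = ?D"
    using has_gateaux_deriv_imp_eq[OF G_fun_gateaux[OF assms(1,2,3,5)]] .
  then have "\<forall>\<^sub>F \<epsilon> in at 0. 2 * ?E = (gateaux_deriv (G_fun a b g) (\<lambda>x. \<psi> x + \<epsilon> * h x) k
      - gateaux_deriv (G_fun a b g) \<psi> k) / \<epsilon>"
    by (simp add: deriv eventually_at_filter)
  then have "has_gateaux_deriv2 (G_fun a b g) \<psi> h k (2 * ?E)"
    unfolding has_gateaux_deriv2_def has_gateaux_deriv_def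
    by (rule Lim_transform_eventually[OF tendsto_const])
  then show ?thesis
    by (simp add: L2_inner_def neg_inv_laplacian_def u_sol_def mult.commute)
qed

text \<open>Green's identity for the solution with itself gives the integral of
  \<open>v x * v x\<close>. If this were 0, then \<open>v = 0\<close>, so \<open>T_D a h\<close>,
  being minus its derivative, would vanish, and with it \<open>h\<close>.\<close>

lemma neg_inv_laplacian_pos:
  assumes "a < b" "L2 a b h" "\<not> L2_eq a b h (\<lambda>x. 0)"
  shows "L2_inner a b (neg_inv_laplacian a b (T_D a h)) (T_D a h) > 0"
proof -
  obtain v where y: "classical_sol a b (T_D a h) (u_sol a b h) v"
    using u_sol_classical[OF assms(1,2)] .
  have eq: "L2_inner a b (neg_inv_laplacian a b (T_D a h)) (T_D a h) = (LINT x|lebesgue_on {a..b}. v x * v x)"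
    using classical_sol_green[OF assms(1) y y]
    by (simp add: L2_inner_def neg_inv_laplacian_def u_sol_def mult.commute)
  have "(LINT x|lebesgue_on {a..b}. v x * v x) \<noteq> 0"
  proof
    assume "(LINT x|lebesgue_on {a..b}. v x * v x) = 0"
    then have v: "v x = 0" if "x \<in> {a..b}" for x
      using LINT_nonneg_eq_0D[of a b "\<lambda>x. v x * v x" x] that assms(1)
      by (auto intro!: continuous_intros classical_sol_continuous(3)[OF y])
    have "T_D a h x = 0" if x: "x \<in> {a..b}" for x
    proof -
      have "(v has_real_derivative 0) (at x within {a..b})"
        by (rule has_field_derivative_transform_within[of "\<lambda>_. 0" _ _ _ 1]) (use v x in auto)
      moreover have "(v has_real_derivative - T_D a h x) (at x within {a..b})"
        using y x by (simp add: classical_sol_def)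
      ultimately show ?thesis
        using vector_derivative_unique_within_closed_interval[of a b x v 0 "- T_D a h x"] assms(1) x
        by (simp add: has_real_derivative_iff_has_vector_derivative)
    qed
    then show False
      using T_D_eq_0D[OF assms(1,2)] assms(3) by blast
  qed
  moreover have "(LINT x|lebesgue_on {a..b}. v x * v x) \<ge> 0"
    by (intro integral_nonneg_AE) simp
  ultimately show ?thesis
    using eq by linarith
qed

lemma T_D_is_L2_adjoint: "is_L2_adjoint a b (T_D a) (\<lambda>f x. LINT \<xi>|lebesgue_on {x..b}. f \<xi>)"
  unfolding is_L2_adjoint_def using T_D_L2 T_D_adjoint_L2 T_D_adjoint by blast

lemma is_L2_adjoint_unique:
  assumes "is_L2_adjoint a b T S" "is_L2_adjoint a b T S'" "L2 a b f"
  shows "L2_eq a b (S f) (S' f)"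
  by (rule L2_eq_if_inner_eq) (use assms in \<open>auto simp: is_L2_adjoint_def\<close>)

lemma is_L2_gradient_unique:
  assumes "is_L2_gradient a b F \<psi> z" "is_L2_gradient a b F \<psi> z'"
  shows "L2_eq a b z z'"
  by (rule L2_eq_if_inner_eq)
    (use assms has_gateaux_deriv_unique in \<open>auto simp: is_L2_gradient_def\<close>)

text \<open>The first derivative pairs \<open>T_D a h\<close> with the continuous function
  \<open>- 2 * (u - u\<^sub>\<psi>)\<close>; any adjoint \<open>S\<close> moves the operator to the
  second factor.\<close>

lemma G_fun_gradient:
  assumes "a < b" "sobolev 1 a b g" "L2 a b \<psi>" "is_L2_adjoint a b (T_D a) S"
  shows "is_L2_gradient a b (G_fun a b g) \<psi> (S (\<lambda>x. - 2 * (u_data a b g x - u_sol a b \<psi> x)))"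
proof -
  let ?F = "\<lambda>x. - 2 * (u_data a b g x - u_sol a b \<psi> x)"
  obtain v0 v where sols: "classical_sol a b (\<lambda>x. g x - g a) (u_data a b g) v0"
    "classical_sol a b (T_D a \<psi>) (u_sol a b \<psi>) v"
    using u_data_classical[OF assms(1,2)] u_sol_classical[OF assms(1,3)] by metis
  have F: "L2 a b ?F"
    by (intro continuous_imp_L2 continuous_intros sols[THEN classical_sol_continuous(2)])
  show ?thesis
    unfolding is_L2_gradient_def
  proof (intro conjI allI impI)
    show "L2 a b (S ?F)"
      using assms(4) F by (simp add: is_L2_adjoint_def)
    fix h assume h: "L2 a b h"
    have "L2_inner a b h (S ?F) = L2_inner a b (T_D a h) ?F"
      using assms(4) F h by (simp add: is_L2_adjoint_def)
    then show "has_gateaux_deriv (G_fun a b g) \<psi> h (L2_inner a b h (S ?F))"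
      using G_fun_gateaux[OF assms(1-3) h] by (simp add: L2_inner_def)
  qed
qed

theorem theorem3p1:
  fixes a b :: real and g u :: "real \<Rightarrow> real" and G :: "(real \<Rightarrow> real) \<Rightarrow> real"
  assumes "a < b" and "sobolev 1 a b g"
  defines "u \<equiv> u_data a b g" and "G \<equiv> G_fun a b g"
  shows
    "\<comment> \<open>(i)\<close>
     (\<forall>\<psi>. L2 a b \<psi> \<longrightarrow>
        G \<psi> = (L2_norm a b (\<lambda>x. wderiv a b u x - wderiv a b (u_sol a b \<psi>) x))\<^sup>2 \<and>
        G \<psi> = (LINT x|lebesgue_on {a..b}.
                 ((wderiv a b u x)\<^sup>2 - (wderiv a b (u_sol a b \<psi>) x)\<^sup>2)
                 - 2 * T_D a \<psi> x * (u x - u_sol a b \<psi> x))) \<and>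
     \<comment> \<open>(ii)\<close>
     (\<forall>\<psi>1 \<psi>2. L2 a b \<psi>1 \<longrightarrow> L2 a b \<psi>2 \<longrightarrow>
        G \<psi>1 - G \<psi>2 =
          (LINT x|lebesgue_on {a..b}.
             - 2 * T_D a (\<lambda>y. \<psi>1 y - \<psi>2 y) x
                 * (u x - (u_sol a b \<psi>1 x + u_sol a b \<psi>2 x) / 2))) \<and>
     \<comment> \<open>(iii): derivative, adjoint (existence and uniqueness in L2), gradient (existence and uniqueness in L2)\<close>
     (\<forall>\<psi> h. L2 a b \<psi> \<longrightarrow> L2 a b h \<longrightarrow>
        has_gateaux_deriv G \<psi> h
          (LINT x|lebesgue_on {a..b}. T_D a h x * (- 2 * (u x - u_sol a b \<psi> x)))) \<and>
     is_L2_adjoint a b (T_D a) (\<lambda>f x. LINT \<xi>|lebesgue_on {x..b}. f \<xi>) \<and>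
     (\<forall>S. is_L2_adjoint a b (T_D a) S \<longrightarrow>
        (\<forall>f. L2 a b f \<longrightarrow> L2_eq a b (S f) (\<lambda>x. LINT \<xi>|lebesgue_on {x..b}. f \<xi>)) \<and>
        (\<forall>\<psi>. L2 a b \<psi> \<longrightarrow>
           is_L2_gradient a b G \<psi> (S (\<lambda>x. - 2 * (u x - u_sol a b \<psi> x))) \<and>
           (\<forall>z. is_L2_gradient a b G \<psi> z \<longrightarrow>
                L2_eq a b z (S (\<lambda>x. - 2 * (u x - u_sol a b \<psi> x)))))) \<and>
     \<comment> \<open>(iv)\<close>
     (\<forall>\<psi> h k. L2 a b \<psi> \<longrightarrow> L2 a b h \<longrightarrow> L2 a b k \<longrightarrow>
        has_gateaux_deriv2 G \<psi> h k
          (2 * L2_inner a b (neg_inv_laplacian a b (T_D a h)) (T_D a k))) \<and>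
     (\<forall>\<psi> h. L2 a b \<psi> \<longrightarrow> L2 a b h \<longrightarrow> \<not> L2_eq a b h (\<lambda>x. 0) \<longrightarrow>
        gateaux_deriv2 G \<psi> h h > 0)"
proof (intro conjI allI impI)
  fix \<psi> assume \<psi>: "L2 a b \<psi>"
  show "G \<psi> = (L2_norm a b (\<lambda>x. wderiv a b u x - wderiv a b (u_sol a b \<psi>) x))\<^sup>2"
    by (simp add: G_def u_def G_fun_def L2_norm_def L2_inner_def algebra_simps)
  show "G \<psi> = (LINT x|lebesgue_on {a..b}.
      ((wderiv a b u x)\<^sup>2 - (wderiv a b (u_sol a b \<psi>) x)\<^sup>2)
      - 2 * T_D a \<psi> x * (u x - u_sol a b \<psi> x))"
    unfolding G_def u_def by (rule G_fun_eq_energy[OF assms(1,2) \<psi>])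
next
  fix \<psi>1 \<psi>2 assume "L2 a b \<psi>1" "L2 a b \<psi>2"
  then show "G \<psi>1 - G \<psi>2 = (LINT x|lebesgue_on {a..b}.
      - 2 * T_D a (\<lambda>y. \<psi>1 y - \<psi>2 y) x * (u x - (u_sol a b \<psi>1 x + u_sol a b \<psi>2 x) / 2))"
    unfolding G_def u_def by (rule G_fun_diff[OF assms(1,2)])
next
  fix \<psi> h assume "L2 a b \<psi>" "L2 a b h"
  then show "has_gateaux_deriv G \<psi> h
      (LINT x|lebesgue_on {a..b}. T_D a h x * (- 2 * (u x - u_sol a b \<psi> x)))"
    unfolding G_def u_def by (rule G_fun_gateaux[OF assms(1,2)])
next
  show "is_L2_adjoint a b (T_D a) (\<lambda>f x. LINT \<xi>|lebesgue_on {x..b}. f \<xi>)"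
    by (rule T_D_is_L2_adjoint)
next
  fix S f assume "is_L2_adjoint a b (T_D a) S" "L2 a b f"
  then show "L2_eq a b (S f) (\<lambda>x. LINT \<xi>|lebesgue_on {x..b}. f \<xi>)"
    using is_L2_adjoint_unique[OF _ T_D_is_L2_adjoint] by blast
next
  fix S \<psi> assume "is_L2_adjoint a b (T_D a) S" "L2 a b \<psi>"
  then show grad: "is_L2_gradient a b G \<psi> (S (\<lambda>x. - 2 * (u x - u_sol a b \<psi> x)))"
    unfolding G_def u_def by (intro G_fun_gradient[OF assms(1,2)])
  fix z assume "is_L2_gradient a b G \<psi> z"
  then show "L2_eq a b z (S (\<lambda>x. - 2 * (u x - u_sol a b \<psi> x)))"
    using grad by (rule is_L2_gradient_unique)
next
  fix \<psi> h k assume "L2 a b \<psi>" "L2 a b h" "L2 a b k"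
  then show "has_gateaux_deriv2 G \<psi> h k
      (2 * L2_inner a b (neg_inv_laplacian a b (T_D a h)) (T_D a k))"
    unfolding G_def by (rule G_fun_gateaux2[OF assms(1,2)])
next
  fix \<psi> h assume h: "L2 a b \<psi>" "L2 a b h" "\<not> L2_eq a b h (\<lambda>x. 0)"
  have "gateaux_deriv2 G \<psi> h h = 2 * L2_inner a b (neg_inv_laplacian a b (T_D a h)) (T_D a h)"
    using G_fun_gateaux2[OF assms(1,2) h(1,2,2)]
    unfolding G_def has_gateaux_deriv2_def gateaux_deriv2_def by (rule has_gateaux_deriv_imp_eq)
  then show "gateaux_deriv2 G \<psi> h h > 0"
    using neg_inv_laplacian_pos[OF assms(1) h(2,3)] by simp
qed

end
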